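(* Let $\ell:\mathbb{R}\to\mathbb{R}$ be a proper convex loss function, let $f:\mathbb{R}\to\{-1,+1\}$ be a (possibly random) label function, let $\mathbf{x}_0\in\mathbb{R}^n$ with $\|\mathbf{x}_0\|_2=1$, let $\mathbf{a}_i\in\mathbb{R}^n$, $i=1,\dots,m$, have i.i.d. standard normal entries, and let $y_i=f(\mathbf{a}_i^T\mathbf{x}_0)$. Consider the limit $m,n\to\infty$, $m/n\to\delta$, and assume $\delta>1$ is such that the set of minimizers of $\min_{\mathbf{x}}\frac1m\sum_{i=1}^m\ell(y_i\mathbf{a}_i^T\mathbf{x})$ is bounded and the system of equations $$\mathbb{E}\big[YS\cdot\mathcal{M}'_{\ell,1}(\alpha G+\mu SY;\lambda)\big]=0,$$ $$\lambda^2\delta\,\mathbb{E}\big[\big(\mathcal{M}'_{\ell,1}(\alpha G+\mu SY;\lambda)\big)^2\big]=\alpha^2,$$ $$\lambda\delta\,\mathbb{E}\big[G\cdot\mathcal{M}'_{\ell,1}(\alpha G+\mu SY;\lambda)\big]=\alpha$$ has a unique solution $(\mu,\alpha\ge0,\lambda\ge0)$, such that $\mu\ne0$. For $\sigma>0$ define the random variable $W_\sigma:=\sigma G+SY$, and define the function $\kappa:(0,\infty]\to[0,1]$ by $$\kappa(\sigma):=\frac{\sigma^2\left(\sigma^2\mathcal{I}(W_\sigma)+\mathcal{I}(W_\sigma)-1\right)}{1+\sigma^2\left(\sigma^2\mathcal{I}(W_\sigma)-1\right)}.$$ Further define $$\sigma_{\rm opt}:=\min\left\{\sigma\ge0:\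 \kappa(\sigma)=\frac1\delta\right\}.$$ Then, for $\sigma_\ell:=\frac{\alpha}{\mu}$, it holds that $\sigma_\ell\ge\sigma_{\rm opt}$.
   Context: $G,S$ are i.i.d. $\mathcal{N}(0,1)$ and $Y=f(S)$; expectations are with respect to the randomness of $G$, $S$ and $Y$. For $\lambda>0$, $\mathcal{M}_\ell(x;\lambda)=\min_v\frac{1}{2\lambda}(x-v)^2+\ell(v)$ is the Moreau envelope of $\ell$, and $\mathcal{M}'_{\ell,1}(x;\lambda)=\frac{\partial}{\partial x}\mathcal{M}_\ell(x;\lambda)$ is its derivative in the first argument. For a random variable $H$ with differentiable density $p_H$, the score function is $\xi_H(h)=p_H'(h)/p_H(h)$ and the Fisher information is $\mathcal{I}(H)=\mathbb{E}[(\xi_H(H))^2]$. In the definition of $\sigma_{\rm opt}$, the value of $\kappa$ at $0$ is taken as $\kappa(0)=0$.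
   Formalization: The ratio σ_ℓ is taken as |α/μ|, since for μ<0 (e.g. squared loss with f = −sign) α/μ is negative and the stated inequality fails; solutions are taken with λ>0, where the Moreau envelope is defined. *)

theory Defs
  imports "HOL-Probability.Probability"
begin

definition moreau :: "(real \<Rightarrow> real) \<Rightarrow> real \<Rightarrow> real \<Rightarrow> real" where
  "moreau loss x lam = (INF v. 1 / (2 * lam) * (x - v)\<^sup>2 + loss v)"

definition moreau_deriv :: "(real \<Rightarrow> real) \<Rightarrow> real \<Rightarrow> real \<Rightarrow> real" where
  "moreau_deriv loss x lam = deriv (\<lambda>t. moreau loss t lam) x"

text \<open>A differentiable density is unique if it exists: densities agree almost everywhere, and
  continuous functions that agree almost everywhere are equal.\<close>

definition diff_density :: "'w measure \<Rightarrow> ('w \<Rightarrow> real) \<Rightarrow> real \<Rightarrow> real" where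
  "diff_density M H = (THE p. (\<forall>h. 0 \<le> p h) \<and> (\<forall>h. p differentiable (at h)) \<and>
     distributed M lborel H (\<lambda>h. ennreal (p h)))"

definition score :: "'w measure \<Rightarrow> ('w \<Rightarrow> real) \<Rightarrow> real \<Rightarrow> real" where
  "score M H h = deriv (diff_density M H) h / diff_density M H h"

definition fisher_info :: "'w measure \<Rightarrow> ('w \<Rightarrow> real) \<Rightarrow> real" where
  "fisher_info M H = (\<integral>\<omega>. (score M H (H \<omega>))\<^sup>2 \<partial>M)"

definition kappa :: "'w measure \<Rightarrow> ('w \<Rightarrow> real) \<Rightarrow> ('w \<Rightarrow> real) \<Rightarrow> ('w \<Rightarrow> real) \<Rightarrow> real \<Rightarrow> real" where
  "kappa M G S Y \<sigma> =
     (if \<sigma> = 0 then 0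
      else let I = fisher_info M (\<lambda>\<omega>. \<sigma> * G \<omega> + S \<omega> * Y \<omega>)
           in \<sigma>\<^sup>2 * (\<sigma>\<^sup>2 * I + I - 1) / (1 + \<sigma>\<^sup>2 * (\<sigma>\<^sup>2 * I - 1)))"

definition sigma_opt ::
  "'w measure \<Rightarrow> ('w \<Rightarrow> real) \<Rightarrow> ('w \<Rightarrow> real) \<Rightarrow> ('w \<Rightarrow> real) \<Rightarrow> real \<Rightarrow> real" where
  "sigma_opt M G S Y \<delta> = (LEAST \<sigma>. 0 \<le> \<sigma> \<and> kappa M G S Y \<sigma> = 1 / \<delta>)"

text \<open>The Bochner integral of a non-integrable function is 0, so a solution is explicitly
  required to make the three expectations finite. The Moreau envelope is defined only for
  \<open>lam > 0\<close>, so a solution has \<open>lam > 0\<close>; evaluating the formula at \<open>lam = 0\<close> with \<open>1 / 0 = 0\<close> would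
  make every \<open>(\<mu>, 0, 0)\<close> a spurious solution.\<close>

definition system_solution ::
  "'w measure \<Rightarrow> ('w \<Rightarrow> real) \<Rightarrow> ('w \<Rightarrow> real) \<Rightarrow> ('w \<Rightarrow> real) \<Rightarrow> (real \<Rightarrow> real) \<Rightarrow> real
     \<Rightarrow> real \<Rightarrow> real \<Rightarrow> real \<Rightarrow> bool" where
  "system_solution M G S Y loss \<delta> \<mu> \<alpha> lam \<longleftrightarrow>
     0 \<le> \<alpha> \<and> 0 < lam \<and>
     (let D = (\<lambda>\<omega>. moreau_deriv loss (\<alpha> * G \<omega> + \<mu> * S \<omega> * Y \<omega>) lam) in
        integrable M (\<lambda>\<omega>. Y \<omega> * S \<omega> * D \<omega>) \<and>
        integrable M (\<lambda>\<omega>. (D \<omega>)\<^sup>2) \<and>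
        integrable M (\<lambda>\<omega>. G \<omega> * D \<omega>) \<and>
        (\<integral>\<omega>. Y \<omega> * S \<omega> * D \<omega> \<partial>M) = 0 \<and>
        lam\<^sup>2 * \<delta> * (\<integral>\<omega>. (D \<omega>)\<^sup>2 \<partial>M) = \<alpha>\<^sup>2 \<and>
        lam * \<delta> * (\<integral>\<omega>. G \<omega> * D \<omega> \<partial>M) = \<alpha>)"

text \<open>The ratio \<open>\<alpha> / \<mu>\<close> is taken in absolute value. It is a noise level, an argument of \<open>kappa\<close>; the sign of
  \<open>\<mu>\<close> carries no information, as replacing \<open>f\<close> by \<open>-f\<close> turns a solution \<open>(\<mu>, \<alpha>, lam)\<close> into
  \<open>(-\<mu>, \<alpha>, lam)\<close> and leaves \<open>sigma_opt\<close> unchanged.\<close>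

definition sigma_loss :: "real \<Rightarrow> real \<Rightarrow> real" where
  "sigma_loss \<mu> \<alpha> = \<bar>\<alpha> / \<mu>\<bar>"

text \<open>Vectors of dimension \<open>n\<close> are functions on \<open>{..<n}\<close>, extensional where a set of vectors is
  formed; \<open>L2_set x {..<n}\<close> is the Euclidean norm.\<close>

definition dotp :: "nat \<Rightarrow> (nat \<Rightarrow> real) \<Rightarrow> (nat \<Rightarrow> real) \<Rightarrow> real" where
  "dotp n a x = (\<Sum>j<n. a j * x j)"

definition empirical_risk ::
  "(real \<Rightarrow> real) \<Rightarrow> nat \<Rightarrow> nat \<Rightarrow> (nat \<Rightarrow> nat \<Rightarrow> real) \<Rightarrow> (nat \<Rightarrow> real) \<Rightarrow> (nat \<Rightarrow> real) \<Rightarrow> real" where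
  "empirical_risk loss m n a y x = 1 / real m * (\<Sum>i<m. loss (y i * dotp n (a i) x))"

definition minimizers ::
  "(real \<Rightarrow> real) \<Rightarrow> nat \<Rightarrow> nat \<Rightarrow> (nat \<Rightarrow> nat \<Rightarrow> real) \<Rightarrow> (nat \<Rightarrow> real) \<Rightarrow> (nat \<Rightarrow> real) set" where
  "minimizers loss m n a y =
     {x \<in> extensional {..<n}.
        \<forall>z \<in> extensional {..<n}. empirical_risk loss m n a y x \<le> empirical_risk loss m n a y z}"

definition bounded_vectors :: "nat \<Rightarrow> (nat \<Rightarrow> real) set \<Rightarrow> bool" where
  "bounded_vectors n X \<longleftrightarrow> (\<exists>B. \<forall>x\<in>X. L2_set x {..<n} \<le> B)"

text \<open>A random label function is a map \<open>f s u\<close> of the argument \<open>s\<close> and of a noise value \<open>u\<close>, which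
  is drawn from a fixed law \<open>\<nu>\<close> afresh for each label. Real-valued noise is no restriction: with
  \<open>u\<close> uniform on the unit interval, a label equal to 1 with probability \<open>p s\<close> is
  \<open>if u \<le> p s then 1 else -1\<close>. A deterministic \<open>f\<close> ignores \<open>u\<close>.\<close>

definition label_function :: "(real \<Rightarrow> real \<Rightarrow> real) \<Rightarrow> bool" where
  "label_function f \<longleftrightarrow> (\<lambda>(s, u). f s u) \<in> borel_measurable (borel \<Otimes>\<^sub>M borel) \<and>
     (\<forall>s u. f s u \<in> {-1, 1})"

definition gaussian_features ::
  "'w measure \<Rightarrow> real measure \<Rightarrow> nat \<Rightarrow> nat \<Rightarrow> (nat \<Rightarrow> nat \<Rightarrow> 'w \<Rightarrow> real) \<Rightarrow> (nat \<Rightarrow> 'w \<Rightarrow> real) \<Rightarrow> bool"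
  where
  "gaussian_features M \<nu> m n a u \<longleftrightarrow>
     prob_space.indep_vars M (\<lambda>_. borel) (case_sum (\<lambda>(i, j). a i j) u)
       (({..<m} \<times> {..<n}) <+> {..<m}) \<and>
     (\<forall>i<m. \<forall>j<n. distributed M lborel (a i j) std_normal_density) \<and>
     (\<forall>i<m. distr M borel (u i) = \<nu>)"

definition gaussian_model ::
  "'w measure \<Rightarrow> real measure \<Rightarrow> ('w \<Rightarrow> real) \<Rightarrow> ('w \<Rightarrow> real) \<Rightarrow> ('w \<Rightarrow> real) \<Rightarrow> bool" where
  "gaussian_model M \<nu> G S U \<longleftrightarrow>
     prob_space.indep_vars M (\<lambda>_. borel) ((!) [G, S, U]) {..<3} \<and>
     distributed M lborel G std_normal_density \<and>
     distributed M lborel S std_normal_density \<and>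
     distr M borel U = \<nu>"

end

theory Submission
  imports Defs
begin

text \<open>
Write \<open>X = S Y\<close>, \<open>W = \<sigma> G + X\<close>, \<open>g(W) = E[G | W]\<close> and \<open>J(\<sigma>) = E[g(W)\<^sup>2]\<close>. By Tweedie's formula the
score of \<open>W\<close> is \<open>- g(W) / \<sigma>\<close>, so \<open>J(\<sigma>) = \<sigma>\<^sup>2 I(W)\<close> and
\<open>\<kappa>(\<sigma>) = (\<sigma>\<^sup>2 J + J - \<sigma>\<^sup>2) / (1 - \<sigma>\<^sup>2 + \<sigma>\<^sup>2 J)\<close>. This quotient is a squared distance: since
\<open>E[X | W] = W - \<sigma> g(W)\<close>, the denominator is \<open>E[E[X | W]\<^sup>2]\<close>, and \<open>\<kappa>(\<sigma>)\<close> is the minimum over \<open>c\<close> of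
\<open>E[(g(W) + c E[X | W])\<^sup>2]\<close>, the energy of the part of \<open>E[G | W]\<close> that is orthogonal to \<open>E[X | W]\<close>.

Let \<open>\<sigma> = \<alpha> / \<bar>\<mu>\<bar>\<close>. The derivative of the envelope in the system is a function \<open>h(W)\<close> (after replacing
\<open>G\<close> by \<open>sgn \<mu> G\<close>), and the system says that \<open>h(W)\<close> is uncorrelated with \<open>X\<close> and that
\<open>E[h(W)\<^sup>2] = \<delta> E[G h(W)]\<^sup>2\<close>. For every \<open>c\<close> the first equation gives
\<open>E[G h(W)] = E[(g(W) + c E[X | W]) h(W)]\<close>. The Cauchy-Schwarz inequality with the optimal \<open>c\<close> yields
\<open>E[G h(W)]\<^sup>2 \<le> \<kappa>(\<sigma>) E[h(W)\<^sup>2]\<close> (\<open>correlation_bound\<close>), hence \<open>1 / \<delta> \<le> \<kappa>(\<sigma>)\<close>.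

It remains to see that \<open>\<kappa>\<close> attains the level \<open>1 / \<delta>\<close> on \<open>[0, \<sigma>]\<close> and does so at a smallest point. This holds
because \<open>\<kappa>\<close> is continuous on \<open>[0, \<infinity>)\<close> with \<open>\<kappa>(0) = 0\<close>, which reduces to the continuity of \<open>J\<close>
(\<open>continuous_on_noise_energy\<close>). Away from \<open>0\<close> this is dominated convergence. At \<open>0\<close> it is essential that \<open>X\<close>
has a density \<open>d\<close>, bounded by twice the normal density: approximating \<open>d\<close> in mean by continuous functions
shows that \<open>E|g(W)|\<close> vanishes in the limit, and a fourth moment bound upgrades this to \<open>J(\<sigma>) \<rightarrow> 0\<close>.

Finally \<open>\<alpha> = 0\<close> is impossible. In that case the derivative of the envelope vanishes at \<open>\<mu> X\<close> almost surely,
so \<open>\<mu> X\<close> minimises the loss, a condition that does not involve the parameter of the envelope. Hence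
\<open>(\<mu>, 0, 2 lam)\<close> would be a second solution (\<open>system_solution_noiseless_rescale\<close>).
\<close>

section \<open>Derivative of the Moreau envelope\<close>

lemma convex_has_subgradient:
  fixes F :: "real \<Rightarrow> real"
  assumes "convex_on UNIV F"
  obtains a where "\<And>t. F x + a * (t - x) \<le> F t"
proof -
  have "\<exists>a. \<forall>t. F x + a * (t - x) \<le> F t"
    using convex_le_Inf_differential[OF assms, of x] by auto
  then show thesis using that by blast
qed

text \<open>
A lower line and an upper parabola that touch at \<open>x\<close> have the same slope there, which is then the derivative
of anything between them.
\<close>

lemma sandwiched_imp_DERIV:
  fixes F :: "real \<Rightarrow> real"
  assumes lower: "\<And>t. F x + a * (t - x) \<le> F t"
    and upper: "\<And>t. F t \<le> F x + b * (t - x) + C * (t - x)\<^sup>2"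
  shows "(F has_real_derivative a) (at x)"
proof -
  \<comment> \<open>Dividing by \<open>h\<close> and letting \<open>h\<close> tend to \<open>0\<close> from each side gives \<open>a = b\<close>.\<close>
  have step: "a * h \<le> b * h + C * h\<^sup>2" for h
    using lower[of "x + h"] upper[of "x + h"] by simp
  have lim: "((\<lambda>h. b + C * h) \<longlongrightarrow> b + C * 0) F'" if "F' \<le> at 0" for F' :: "real filter"
    by (intro tendsto_intros tendsto_mono[OF that]) 
  have "a \<le> b"
  proof (rule tendsto_lowerbound)
    show "((\<lambda>h. b + C * h) \<longlongrightarrow> b) (at_right 0)"
      using lim[of "at_right 0"] by (simp add: at_le)
    show "\<forall>\<^sub>F h in at_right 0. a \<le> b + C * h"
      unfolding eventually_at_filter
    proof (intro always_eventually allI impI)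
      fix h :: real assume "h \<noteq> 0" "h \<in> {0<..}"
      then have "0 < h" by simp
      have "a * h \<le> (b + C * h) * h" using step[of h] by (simp add: algebra_simps power2_eq_square)
      then show "a \<le> b + C * h" using \<open>0 < h\<close> by simp
    qed
  qed simp
  moreover have "b \<le> a"
  proof (rule tendsto_upperbound)
    show "((\<lambda>h. b + C * h) \<longlongrightarrow> b) (at_left 0)"
      using lim[of "at_left 0"] by (simp add: at_le)
    show "\<forall>\<^sub>F h in at_left 0. b + C * h \<le> a"
      unfolding eventually_at_filter
    proof (intro always_eventually allI impI)
      fix h :: real assume "h \<noteq> 0" "h \<in> {..<0}"
      then have "h < 0" by simp
      have "a * h \<le> (b + C * h) * h" using step[of h] by (simp add: algebra_simps power2_eq_square)
      then show "b + C * h \<le> a" using \<open>h < 0\<close> by simp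
    qed
  qed simp
  ultimately have ab: "b = a" by simp
  have "((\<lambda>h. (F (x + h) - F x) / h - a) \<longlongrightarrow> 0) (at 0)"
  proof (rule Lim_null_comparison)
    show "\<forall>\<^sub>F h in at 0. norm ((F (x + h) - F x) / h - a) \<le> \<bar>C\<bar> * \<bar>h\<bar>"
      unfolding eventually_at_filter
    proof (intro always_eventually allI impI)
      fix h :: real assume h: "h \<noteq> 0"
      have "\<bar>F (x + h) - F x - a * h\<bar> \<le> \<bar>C\<bar> * \<bar>h\<bar> * \<bar>h\<bar>"
      proof -
        have "\<bar>F (x + h) - F x - a * h\<bar> \<le> C * h\<^sup>2"
          using lower[of "x + h"] upper[of "x + h"] ab by simp
        also have "\<dots> \<le> \<bar>C\<bar> * h\<^sup>2" by (simp add: mult_right_mono)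
        finally show ?thesis by (simp add: power2_eq_square mult.assoc abs_mult_self_eq)
      qed
      moreover have "(F (x + h) - F x) / h - a = (F (x + h) - F x - a * h) / h"
        using h by (simp add: field_simps)
      ultimately show "norm ((F (x + h) - F x) / h - a) \<le> \<bar>C\<bar> * \<bar>h\<bar>"
        using h by (simp add: abs_divide divide_le_eq)
    qed
    show "((\<lambda>h. \<bar>C\<bar> * \<bar>h\<bar>) \<longlongrightarrow> 0) (at (0::real))"
      by (rule tendsto_eq_intros refl)+ simp
  qed
  then have "((\<lambda>h. (F (x + h) - F x) / h) \<longlongrightarrow> a) (at 0)"
    by (simp add: LIM_zero_cancel)
  then show ?thesis by (simp add: DERIV_def)
qed

context
  fixes loss :: "real \<Rightarrow> real" and lam :: real
  assumes convex: "convex_on UNIV loss" and lam: "0 < lam"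
begin

lemma moreau_bdd_below: "bdd_below (range (\<lambda>v. 1 / (2 * lam) * (x - v)\<^sup>2 + loss v))"
proof -
  obtain a where a: "\<And>t. loss x + a * (t - x) \<le> loss t"
    using convex_has_subgradient[OF convex, of x] by blast
  \<comment> \<open>The constant is the minimum over \<open>v\<close> of the parabola plus the affine minorant of the loss at \<open>x\<close>.\<close>
  have "loss x - lam * a\<^sup>2 / 2 \<le> 1 / (2 * lam) * (x - v)\<^sup>2 + loss v" for v
  proof -
    have "0 \<le> 1 / (2 * lam) * ((v - x) + lam * a)\<^sup>2" using lam by simp
    also have "\<dots> = 1 / (2 * lam) * (x - v)\<^sup>2 + a * (v - x) + lam * a\<^sup>2 / 2"
      using lam by (simp add: field_simps power2_eq_square)
    finally show ?thesis using a[of v] by simp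
  qed
  then show ?thesis by (intro bdd_belowI) auto
qed

lemma moreau_le: "moreau loss x lam \<le> 1 / (2 * lam) * (x - v)\<^sup>2 + loss v"
  unfolding moreau_def by (rule cINF_lower[OF moreau_bdd_below]) simp

lemma moreau_greatest:
  assumes "\<And>v. c \<le> 1 / (2 * lam) * (x - v)\<^sup>2 + loss v"
  shows "c \<le> moreau loss x lam"
  unfolding moreau_def by (rule cINF_greatest) (use assms in auto)

lemma moreau_approx:
  assumes "0 < e"
  obtains v where "1 / (2 * lam) * (x - v)\<^sup>2 + loss v < moreau loss x lam + e"
  using moreau_greatest[of "moreau loss x lam + e" x] assms
  by (meson add_less_same_cancel1 less_add_same_cancel1 not_less)

lemma moreau_convex: "convex_on UNIV (\<lambda>x. moreau loss x lam)"
proof (rule convex_onI)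
  fix t x y :: real assume t: "0 < t" "t < 1"
  show "moreau loss ((1 - t) *\<^sub>R x + t *\<^sub>R y) lam \<le> (1 - t) * moreau loss x lam + t * moreau loss y lam"
  proof (rule field_le_epsilon)
    fix e :: real assume "0 < e"
    obtain v where v: "1 / (2 * lam) * (x - v)\<^sup>2 + loss v < moreau loss x lam + e"
      using moreau_approx[OF \<open>0 < e\<close>] .
    obtain w where w: "1 / (2 * lam) * (y - w)\<^sup>2 + loss w < moreau loss y lam + e"
      using moreau_approx[OF \<open>0 < e\<close>] .
    let ?c = "1 / (2 * lam)"
    have sq: "((1 - t) * (x - v) + t * (y - w))\<^sup>2 \<le> (1 - t) * (x - v)\<^sup>2 + t * (y - w)\<^sup>2"
    proof -
      have "0 \<le> t * (1 - t) * ((x - v) - (y - w))\<^sup>2" using t by simp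
      also have "\<dots> = (1 - t) * (x - v)\<^sup>2 + t * (y - w)\<^sup>2 - ((1 - t) * (x - v) + t * (y - w))\<^sup>2"
        by algebra
      finally show ?thesis by simp
    qed
    have "moreau loss ((1 - t) *\<^sub>R x + t *\<^sub>R y) lam
        \<le> ?c * (((1 - t) * x + t * y) - ((1 - t) * v + t * w))\<^sup>2 + loss ((1 - t) * v + t * w)"
      using moreau_le[of "(1 - t) *\<^sub>R x + t *\<^sub>R y" "(1 - t) * v + t * w"] by simp
    also have "((1 - t) * x + t * y) - ((1 - t) * v + t * w) = (1 - t) * (x - v) + t * (y - w)"
      by (simp add: algebra_simps)
    also have "?c * ((1 - t) * (x - v) + t * (y - w))\<^sup>2 + loss ((1 - t) * v + t * w)
        \<le> ?c * ((1 - t) * (x - v)\<^sup>2 + t * (y - w)\<^sup>2) + ((1 - t) * loss v + t * loss w)"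
      using convex_onD[OF convex, of t v w] t sq lam by (intro add_mono mult_left_mono) auto
    also have "\<dots> = (1 - t) * (?c * (x - v)\<^sup>2 + loss v) + t * (?c * (y - w)\<^sup>2 + loss w)"
      by (simp add: distrib_left)
    also have "\<dots> \<le> (1 - t) * (moreau loss x lam + e) + t * (moreau loss y lam + e)"
      using t v w by (intro add_mono[OF mult_left_mono mult_left_mono]) auto
    also have "\<dots> = (1 - t) * moreau loss x lam + t * moreau loss y lam + e"
      by (simp add: algebra_simps)
    finally show "moreau loss ((1 - t) *\<^sub>R x + t *\<^sub>R y) lam \<le> \<dots>" .
  qed
qed simp

text \<open>
For fixed \<open>v\<close> the expression under the infimum differs from \<open>x\<^sup>2 / (2 lam)\<close> by an affine function of \<open>x\<close>, and an
infimum of affine functions is concave. Together with convexity this makes the envelope differentiable.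
\<close>

lemma moreau_semiconcave: "convex_on UNIV (\<lambda>x. 1 / (2 * lam) * x\<^sup>2 - moreau loss x lam)"
proof (rule convex_onI)
  fix t x y :: real assume t: "0 < t" "t < 1"
  let ?c = "1 / (2 * lam)" and ?z = "(1 - t) *\<^sub>R x + t *\<^sub>R y"
  have "?c * ?z\<^sup>2 - ((1 - t) * (?c * x\<^sup>2 - moreau loss x lam) + t * (?c * y\<^sup>2 - moreau loss y lam))
      \<le> moreau loss ?z lam"
  proof (rule moreau_greatest)
    fix v
    have "(1 - t) * moreau loss x lam + t * moreau loss y lam
       \<le> (1 - t) * (?c * (x - v)\<^sup>2 + loss v) + t * (?c * (y - v)\<^sup>2 + loss v)"
      using t by (intro add_mono mult_left_mono moreau_le) auto
    moreover have "?c * ?z\<^sup>2 - ((1 - t) * (?c * x\<^sup>2) + t * (?c * y\<^sup>2))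
        + (1 - t) * (?c * (x - v)\<^sup>2 + loss v) + t * (?c * (y - v)\<^sup>2 + loss v)
        = ?c * (?z - v)\<^sup>2 + loss v"
      unfolding real_scaleR_def by algebra
    ultimately show "?c * ?z\<^sup>2 - ((1 - t) * (?c * x\<^sup>2 - moreau loss x lam)
        + t * (?c * y\<^sup>2 - moreau loss y lam)) \<le> ?c * (?z - v)\<^sup>2 + loss v"
      by (simp add: algebra_simps)
  qed
  then show "?c * ?z\<^sup>2 - moreau loss ?z lam
      \<le> (1 - t) * (?c * x\<^sup>2 - moreau loss x lam) + t * (?c * y\<^sup>2 - moreau loss y lam)"
    by simp
qed simp

lemma moreau_subgradient: "moreau loss x lam + moreau_deriv loss x lam * (t - x) \<le> moreau loss t lam"
  and moreau_has_deriv: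
    "((\<lambda>t. moreau loss t lam) has_real_derivative moreau_deriv loss x lam) (at x)"
proof -
  obtain a where a: "\<And>t. moreau loss x lam + a * (t - x) \<le> moreau loss t lam"
    using convex_has_subgradient[OF moreau_convex, of x] by blast
  let ?c = "1 / (2 * lam)"
  obtain b where b: "\<And>t. ?c * x\<^sup>2 - moreau loss x lam + b * (t - x) \<le> ?c * t\<^sup>2 - moreau loss t lam"
    using convex_has_subgradient[OF moreau_semiconcave, of x] by blast
  have "((\<lambda>t. moreau loss t lam) has_real_derivative a) (at x)"
  proof (rule sandwiched_imp_DERIV[OF a])
    fix t
    have "?c * t\<^sup>2 - ?c * x\<^sup>2 = ?c * (2 * x) * (t - x) + ?c * (t - x)\<^sup>2"
      by algebra
    then show "moreau loss t lam \<le> moreau loss x lam + (?c * (2 * x) - b) * (t - x) + ?c * (t - x)\<^sup>2"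
      using b[of t] by (simp add: left_diff_distrib)
  qed
  moreover from this have "a = moreau_deriv loss x lam"
    unfolding moreau_deriv_def by (simp add: DERIV_imp_deriv)
  ultimately show "moreau loss x lam + moreau_deriv loss x lam * (t - x) \<le> moreau loss t lam"
    "((\<lambda>t. moreau loss t lam) has_real_derivative moreau_deriv loss x lam) (at x)"
    using a by auto
qed

lemma moreau_deriv_mono: "mono (\<lambda>x. moreau_deriv loss x lam)"
proof (rule monoI)
  fix x y :: real assume "x \<le> y"
  have "0 \<le> (moreau_deriv loss y lam - moreau_deriv loss x lam) * (y - x)"
    using moreau_subgradient[of x y] moreau_subgradient[of y x] by (simp add: algebra_simps)
  then show "moreau_deriv loss x lam \<le> moreau_deriv loss y lam"
    using \<open>x \<le> y\<close> by (cases "x = y") (auto simp: zero_le_mult_iff)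
qed

lemma moreau_deriv_measurable: "(\<lambda>x. moreau_deriv loss x lam) \<in> borel_measurable borel"
  using moreau_deriv_mono by (rule borel_measurable_mono)

text \<open>
A stationary point of the convex envelope minimises it, and the envelope lies below the loss. Near-optimal
\<open>v\<close> in the infimum must then converge to \<open>x\<close>, so by continuity the envelope and the loss agree at \<open>x\<close>.
\<close>

lemma moreau_deriv_zero_imp_minimizer:
  assumes "moreau_deriv loss x lam = 0"
  shows "loss x \<le> loss v"
proof -
  have min: "moreau loss x lam \<le> loss w" for w
    using moreau_subgradient[of x w] moreau_le[of w w] assms by simp
  let ?b = "\<lambda>n. 1 / real (Suc n)"
  have "\<exists>v. 1 / (2 * lam) * (x - v)\<^sup>2 + loss v < moreau loss x lam + ?b n" for n
    using moreau_approx[of "?b n" x] by auto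
  then obtain V where V: "\<And>n. 1 / (2 * lam) * (x - V n)\<^sup>2 + loss (V n) < moreau loss x lam + ?b n"
    by metis
  have b0: "?b \<longlonglongrightarrow> 0" using LIMSEQ_inverse_real_of_nat by (simp add: inverse_eq_divide)
  have "(\<lambda>n. (V n - x)\<^sup>2) \<longlonglongrightarrow> 0"
  proof (rule Lim_null_comparison)
    show "\<forall>\<^sub>F n in sequentially. norm ((V n - x)\<^sup>2) \<le> 2 * lam * ?b n"
    proof (intro always_eventually allI)
      fix n
      have "1 / (2 * lam) * (x - V n)\<^sup>2 < ?b n" using V[of n] min[of "V n"] by simp
      then show "norm ((V n - x)\<^sup>2) \<le> 2 * lam * ?b n"
        using lam by (simp add: field_simps power2_commute)
    qed
    show "(\<lambda>n. 2 * lam * ?b n) \<longlonglongrightarrow> 0" using tendsto_mult_right[OF b0, of "2 * lam"] by simp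
  qed
  then have "(\<lambda>n. V n - x) \<longlonglongrightarrow> 0"
    using tendsto_real_sqrt[of "\<lambda>n. (V n - x)\<^sup>2" 0] by (simp add: tendsto_rabs_zero_iff)
  then have "V \<longlonglongrightarrow> x" by (simp add: LIM_zero_cancel)
  moreover have "isCont loss x"
    using convex_on_continuous[OF open_UNIV convex] by (simp add: continuous_on_eq_continuous_at)
  ultimately have "(\<lambda>n. loss (V n)) \<longlonglongrightarrow> loss x" by (simp add: isCont_tendsto_compose)
  moreover have "(\<lambda>n. moreau loss x lam + ?b n) \<longlonglongrightarrow> moreau loss x lam"
    using tendsto_add[OF tendsto_const b0] by simp
  moreover have "loss (V n) \<le> moreau loss x lam + ?b n" for n
  proof -
    have "0 \<le> 1 / (2 * lam) * (x - V n)\<^sup>2" using lam by simp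
    then show ?thesis using V[of n] by linarith
  qed
  ultimately have "loss x \<le> moreau loss x lam" by (intro LIMSEQ_le) auto
  then show ?thesis using min[of v] by simp
qed

lemma minimizer_imp_moreau_deriv_zero:
  assumes "\<And>v. loss x \<le> loss v"
  shows "moreau_deriv loss x lam = 0"
proof -
  have "loss x \<le> moreau loss t lam" for t
  proof (rule moreau_greatest)
    fix v
    have "0 \<le> 1 / (2 * lam) * (t - v)\<^sup>2" using lam by simp
    then show "loss x \<le> 1 / (2 * lam) * (t - v)\<^sup>2 + loss v" using assms[of v] by linarith
  qed
  moreover have "moreau loss x lam \<le> loss x" using moreau_le[of x x] by simp
  ultimately have "moreau loss x lam \<le> moreau loss t lam" for t by (meson order_trans)
  then show ?thesis using DERIV_local_min[OF moreau_has_deriv, of 1 x] by simp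
qed

end

section \<open>Gaussian kernels\<close>

lemma std_normal_density_DERIV:
  "(std_normal_density has_real_derivative - (std_normal_density x * x)) (at x)"
proof -
  have "((\<lambda>x. c * exp (- x\<^sup>2 / 2)) has_real_derivative - (c * exp (- x\<^sup>2 / 2) * x)) (at x)" for c :: real
    by (auto intro!: derivative_eq_intros)
  then show ?thesis unfolding std_normal_density_def[abs_def] .
qed

lemma std_normal_density_le_1: "std_normal_density x \<le> 1"
proof -
  have "1 \<le> sqrt (2 * pi)" using pi_gt3 by (simp add: real_le_rsqrt)
  then have "1 / sqrt (2 * pi) \<le> 1" by simp
  moreover have "exp (- x\<^sup>2 / 2) \<le> 1" by simp
  ultimately show ?thesis unfolding std_normal_density_def
    by (intro mult_le_one) auto
qed

lemma std_normal_density_abs_le_1: "std_normal_density x * \<bar>x\<bar> \<le> 1"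
proof -
  have "1 \<le> sqrt (2 * pi)" using pi_gt3 by (simp add: real_le_rsqrt)
  then have c: "1 / sqrt (2 * pi) \<le> 1" by simp
  have "0 \<le> (1 - \<bar>x\<bar>)\<^sup>2" by simp
  then have "\<bar>x\<bar> \<le> 1 + x\<^sup>2 / 2" by (simp add: power2_eq_square algebra_simps abs_mult_self_eq)
  also have "\<dots> \<le> exp (x\<^sup>2 / 2)" by (rule exp_ge_add_one_self)
  finally have "exp (- x\<^sup>2 / 2) * \<bar>x\<bar> \<le> exp (- x\<^sup>2 / 2) * exp (x\<^sup>2 / 2)"
    by (intro mult_left_mono) auto
  also have "\<dots> = 1" by (simp add: exp_add[symmetric])
  finally have "exp (- x\<^sup>2 / 2) * \<bar>x\<bar> \<le> 1" .
  have "1 / sqrt (2 * pi) * (exp (- x\<^sup>2 / 2) * \<bar>x\<bar>) \<le> 1"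
    by (intro mult_le_one[OF c _ \<open>exp (- x\<^sup>2 / 2) * \<bar>x\<bar> \<le> 1\<close>]) simp
  then show ?thesis unfolding std_normal_density_def mult.assoc .
qed

lemma std_normal_density_moment_le_1: "j \<le> 1 \<Longrightarrow> \<bar>std_normal_density x * x ^ j\<bar> \<le> 1"
  using std_normal_density_le_1[of x] std_normal_density_abs_le_1[of x]
  by (cases j) (auto simp: abs_mult)

lemma std_normal_density_Lipschitz: "\<bar>std_normal_density x - std_normal_density y\<bar> \<le> \<bar>x - y\<bar>"
proof -
  have "norm (std_normal_density x - std_normal_density y) \<le> 1 * norm (x - y)"
  proof (rule field_differentiable_bound[where S=UNIV and f'="\<lambda>x. - (std_normal_density x * x)"])
    fix z show "(std_normal_density has_real_derivative - (std_normal_density z * z)) (at z within UNIV)"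
      using std_normal_density_DERIV by simp
    show "norm (- (std_normal_density z * z)) \<le> 1"
      using std_normal_density_abs_le_1[of z] by (simp add: abs_mult)
  qed auto
  then show ?thesis by simp
qed

text \<open>
The integrable majorant in \<open>integrand_bound\<close> has two factors of this form, with \<open>B = 1\<close> in the noise
variable and \<open>B = 1 + b\<close> in the observed one.
\<close>

lemma integrable_gauss_quarter:
  fixes B :: real assumes "0 < B"
  shows "integrable lborel (\<lambda>x. \<bar>x\<bar> ^ j * exp (- x\<^sup>2 / (4 * B)))"
proof -
  have "integrable lborel (\<lambda>x. sqrt (4 * pi * B) * (normal_density 0 (sqrt (2 * B)) x * \<bar>x - 0\<bar> ^ j))"
    using assms by (intro integrable_mult_right integrable_normal_moment_abs) simp
  moreover have "sqrt (4 * pi * B) * (normal_density 0 (sqrt (2 * B)) x * \<bar>x - 0\<bar> ^ j)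
      = \<bar>x\<bar> ^ j * exp (- x\<^sup>2 / (4 * B))" for x
    using assms by (simp add: normal_density_def mult_ac)
  ultimately show ?thesis by (simp only:)
qed

lemma convergent_squares_bounded:
  fixes S :: "nat \<Rightarrow> real"
  assumes "S \<longlonglongrightarrow> s"
  obtains b where "\<And>n. (S n)\<^sup>2 \<le> b"
proof -
  have "Bseq S" using assms by (intro convergent_imp_Bseq convergentI)
  then obtain K where "\<forall>n. \<bar>S n\<bar> \<le> K" unfolding Bseq_def by auto
  then have "(S n)\<^sup>2 \<le> K\<^sup>2" for n by (simp add: abs_le_square_iff[symmetric] order_trans[OF _ abs_ge_self])
  then show thesis by (rule that)
qed

text \<open>
The weight is half of the normal exponent; the other half goes into the decay in the observed variable, see
\<open>integrand_bound\<close>.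
\<close>

definition abs_moment :: "nat \<Rightarrow> real" where
  "abs_moment j = (\<integral>u. \<bar>u\<bar> ^ j * exp (- u\<^sup>2 / 4) \<partial>lborel)"

lemma integrable_abs_moment: "integrable lborel (\<lambda>u::real. \<bar>u\<bar> ^ j * exp (- u\<^sup>2 / 4))"
  using integrable_gauss_quarter[of 1 j] by simp

lemma abs_moment_nonneg: "0 \<le> abs_moment j"
  unfolding abs_moment_def by (intro integral_nonneg_AE) auto

text \<open>
If \<open>e\<close> is the density of a signal and \<open>w\<close> an observed value of the signal plus \<open>s\<close> times a standard normal
noise, this is the \<open>j\<close>-th moment of the noise over the event of observing \<open>w\<close>: for \<open>j = 0\<close> the density of the
observation, for \<open>j = 1\<close> the unnormalised conditional mean of the noise. It is linear in \<open>e\<close>, and signed \<open>e\<close>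
are allowed so that approximation errors of densities can be treated as well.
\<close>

definition noise_moment :: "(real \<Rightarrow> real) \<Rightarrow> nat \<Rightarrow> real \<Rightarrow> real \<Rightarrow> real" where
  "noise_moment e j s w = (\<integral>u. std_normal_density u * u ^ j * e (w - s * u) \<partial>lborel)"

locale gaussian_dominated =
  fixes e :: "real \<Rightarrow> real"
  assumes measurable_e [measurable]: "e \<in> borel_measurable borel"
    and dominated: "\<And>x. \<bar>e x\<bar> \<le> 2 * std_normal_density x"
begin

text \<open>
The exponent \<open>u\<^sup>2 + (w - s u)\<^sup>2\<close> of the product of the two normal densities is at least \<open>u\<^sup>2\<close> and, by the
Cauchy-Schwarz inequality, at least \<open>w\<^sup>2 / (1 + s\<^sup>2)\<close>, hence at least the mean of the two. The majorant is a product
of a function of \<open>w\<close> and a function of \<open>u\<close>, and it is uniform for bounded \<open>s\<close>.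
\<close>

lemma integrand_bound:
  assumes "s\<^sup>2 \<le> b"
  shows "\<bar>std_normal_density u * u ^ j * e (w - s * u)\<bar>
    \<le> exp (- w\<^sup>2 / (4 * (1 + b))) * (\<bar>u\<bar> ^ j * exp (- u\<^sup>2 / 4))"
proof -
  have b: "0 \<le> b" using assms zero_le_power2[of s] by linarith
  have sq: "w\<^sup>2 \<le> (1 + s\<^sup>2) * (u\<^sup>2 + (w - s * u)\<^sup>2)"
  proof -
    have "(1 + s\<^sup>2) * (u\<^sup>2 + (w - s * u)\<^sup>2) - w\<^sup>2 = (u - s * (w - s * u))\<^sup>2" by algebra
    then show ?thesis by (metis diff_ge_0_iff_ge zero_le_power2)
  qed
  also have "\<dots> \<le> (1 + b) * (u\<^sup>2 + (w - s * u)\<^sup>2)"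
    using assms by (intro mult_right_mono) auto
  finally have "w\<^sup>2 / (1 + b) \<le> u\<^sup>2 + (w - s * u)\<^sup>2"
    using b by (simp add: divide_le_eq mult.commute)
  moreover have "C \<le> A + B \<Longrightarrow> 0 \<le> B \<Longrightarrow> - A / 2 + - B / 2 \<le> - (C / 4) + - A / 4" for A B C :: real
    by simp
  ultimately have expo: "- u\<^sup>2 / 2 + - (w - s * u)\<^sup>2 / 2 \<le> - w\<^sup>2 / (4 * (1 + b)) + - u\<^sup>2 / 4"
    by (metis (no_types, lifting) divide_divide_eq_left' minus_divide_left zero_le_power2)
  have "std_normal_density u * \<bar>e (w - s * u)\<bar>
      \<le> std_normal_density u * (2 * std_normal_density (w - s * u))"
    by (intro mult_left_mono dominated) simp
  also have "\<dots> = 1 / pi * exp (- u\<^sup>2 / 2 + - (w - s * u)\<^sup>2 / 2)"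
    unfolding std_normal_density_def exp_add by simp
  also have "\<dots> \<le> 1 * exp (- w\<^sup>2 / (4 * (1 + b)) + - u\<^sup>2 / 4)"
    using expo pi_gt3 by (intro mult_mono) auto
  finally have "std_normal_density u * \<bar>e (w - s * u)\<bar> * \<bar>u\<bar> ^ j
      \<le> exp (- w\<^sup>2 / (4 * (1 + b)) + - u\<^sup>2 / 4) * \<bar>u\<bar> ^ j"
    by (intro mult_right_mono) auto
  then show ?thesis unfolding exp_add by (simp add: abs_mult power_abs mult_ac)
qed

lemma integrable_noise_moment:
  "integrable lborel (\<lambda>u. std_normal_density u * u ^ j * e (w - s * u))"
proof (rule Bochner_Integration.integrable_bound)
  show "integrable lborel (\<lambda>u. exp (- w\<^sup>2 / (4 * (1 + s\<^sup>2))) * (\<bar>u\<bar> ^ j * exp (- u\<^sup>2 / 4)))"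
    using integrable_abs_moment by (rule integrable_mult_right)
qed (use integrand_bound[of s "s\<^sup>2"] in auto)

lemma noise_moment_bound:
  assumes "s\<^sup>2 \<le> b"
  shows "\<bar>noise_moment e j s w\<bar> \<le> abs_moment j * exp (- w\<^sup>2 / (4 * (1 + b)))"
proof -
  have "norm (noise_moment e j s w)
      \<le> (\<integral>u. exp (- w\<^sup>2 / (4 * (1 + b))) * (\<bar>u\<bar> ^ j * exp (- u\<^sup>2 / 4)) \<partial>lborel)"
    unfolding noise_moment_def
  proof (rule Bochner_Integration.integral_norm_bound_integral[OF integrable_noise_moment])
    show "integrable lborel (\<lambda>u. exp (- w\<^sup>2 / (4 * (1 + b))) * (\<bar>u\<bar> ^ j * exp (- u\<^sup>2 / 4)))"
      using integrable_abs_moment by (rule integrable_mult_right)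
  qed (use integrand_bound[OF assms] in simp)
  then show ?thesis by (simp add: abs_moment_def mult.commute)
qed

lemma measurable_noise_moment [measurable]: "noise_moment e j s \<in> borel_measurable borel"
  unfolding noise_moment_def[abs_def] by measurable

lemma integrable_noise_moment_outer: "integrable lborel (noise_moment e j s)"
proof (rule Bochner_Integration.integrable_bound)
  show "integrable lborel (\<lambda>w. abs_moment j * (\<bar>w\<bar> ^ 0 * exp (- w\<^sup>2 / (4 * (1 + s\<^sup>2)))))"
    by (intro integrable_mult_right integrable_gauss_quarter) (simp add: add_pos_nonneg)
qed (use noise_moment_bound[of s "s\<^sup>2"] abs_moment_nonneg in \<open>auto simp: abs_mult\<close>)

lemma integrable_e: "integrable lborel e"
proof (rule Bochner_Integration.integrable_bound)
  show "integrable lborel (\<lambda>x. 2 * std_normal_density x)" by simp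
qed (use dominated in \<open>auto\<close>)

text \<open>
The bound does not depend on \<open>s\<close>: exchange the integrals, translate the inner one, and use that the first
absolute moment of a standard normal variable, \<open>sqrt (2 / pi)\<close>, is at most \<open>1\<close>.
\<close>

lemma integral_abs_noise_moment_le:
  "(\<integral>w. \<bar>noise_moment e 1 s w\<bar> \<partial>lborel) \<le> (\<integral>x. \<bar>e x\<bar> \<partial>lborel)"
proof -
  have "(\<integral>\<^sup>+w. ennreal \<bar>noise_moment e 1 s w\<bar> \<partial>lborel)
      \<le> (\<integral>\<^sup>+w. \<integral>\<^sup>+u. ennreal (std_normal_density u * \<bar>u\<bar>) * ennreal \<bar>e (w - s * u)\<bar> \<partial>lborel \<partial>lborel)"
  proof (rule nn_integral_mono)
    fix w
    have "ennreal (norm (noise_moment e 1 s w))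
        \<le> (\<integral>\<^sup>+u. ennreal (norm (std_normal_density u * u ^ 1 * e (w - s * u))) \<partial>lborel)"
      unfolding noise_moment_def
      by (rule integral_norm_bound_ennreal[OF integrable_noise_moment])
    then show "ennreal \<bar>noise_moment e 1 s w\<bar>
        \<le> (\<integral>\<^sup>+u. ennreal (std_normal_density u * \<bar>u\<bar>) * ennreal \<bar>e (w - s * u)\<bar> \<partial>lborel)"
      by (simp add: abs_mult ennreal_mult)
  qed
  also have "\<dots> = (\<integral>\<^sup>+u. \<integral>\<^sup>+w. ennreal (std_normal_density u * \<bar>u\<bar>) * ennreal \<bar>e (w - s * u)\<bar> \<partial>lborel \<partial>lborel)"
    by (rule lborel_pair.Fubini') measurable
  also have "\<dots> = (\<integral>\<^sup>+u. ennreal (std_normal_density u * \<bar>u\<bar>) * (\<integral>\<^sup>+x. ennreal \<bar>e x\<bar> \<partial>lborel) \<partial>lborel)"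
  proof (rule nn_integral_cong)
    fix u :: real
    have "(\<integral>\<^sup>+x. ennreal \<bar>e x\<bar> \<partial>lborel) = (\<integral>\<^sup>+w. ennreal \<bar>e (w - s * u)\<bar> \<partial>lborel)"
      using nn_integral_real_affine[of "\<lambda>x. ennreal \<bar>e x\<bar>" 1 "- (s * u)"] by (simp add: algebra_simps)
    then show "(\<integral>\<^sup>+w. ennreal (std_normal_density u * \<bar>u\<bar>) * ennreal \<bar>e (w - s * u)\<bar> \<partial>lborel)
        = ennreal (std_normal_density u * \<bar>u\<bar>) * (\<integral>\<^sup>+x. ennreal \<bar>e x\<bar> \<partial>lborel)"
      by (simp add: nn_integral_cmult)
  qed
  also have "\<dots> = (\<integral>\<^sup>+u. ennreal (std_normal_density u * \<bar>u\<bar>) \<partial>lborel) * (\<integral>\<^sup>+x. ennreal \<bar>e x\<bar> \<partial>lborel)"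
    by (rule nn_integral_multc) measurable
  also have "\<dots> \<le> 1 * (\<integral>\<^sup>+x. ennreal \<bar>e x\<bar> \<partial>lborel)"
  proof (rule mult_right_mono)
    have "(\<integral>\<^sup>+u. ennreal (std_normal_density u * \<bar>u\<bar>) \<partial>lborel) = ennreal (sqrt (2 / pi))"
      using nn_integral_eq_integral[OF integrable_std_normal_moment_abs[of 1]]
        integral_std_normal_moment_abs_odd[of 0] by simp
    also have "\<dots> \<le> 1" using pi_gt3 by simp
    finally show "(\<integral>\<^sup>+u. ennreal (std_normal_density u * \<bar>u\<bar>) \<partial>lborel) \<le> 1"
      by (simp add: ennreal_leI)
  qed simp
  finally have "(\<integral>\<^sup>+w. ennreal \<bar>noise_moment e 1 s w\<bar> \<partial>lborel) \<le> (\<integral>\<^sup>+x. ennreal \<bar>e x\<bar> \<partial>lborel)" by simp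
  then show ?thesis
    using integrable_noise_moment_outer[of 1 s] integrable_e
    by (simp add: nn_integral_eq_integral integrable_abs ennreal_le_iff integral_nonneg_AE)
qed

text \<open>
In terms of \<open>x = w - s u\<close> the parameters \<open>s\<close> and \<open>w\<close> occur only in the smooth kernel, so limits and
derivatives in them need no regularity of \<open>e\<close>. The substitution degenerates at \<open>s = 0\<close>.
\<close>

lemma noise_moment_affine:
  assumes "0 < s"
  shows "noise_moment e j s w
    = (\<integral>x. std_normal_density ((w - x) / s) * ((w - x) / s) ^ j * e x / s \<partial>lborel)"
proof -
  have "noise_moment e j s w = \<bar>- 1 / s\<bar> *\<^sub>R (\<integral>x. std_normal_density (w / s + (- 1 / s) * x)
      * (w / s + (- 1 / s) * x) ^ j * e (w - s * (w / s + (- 1 / s) * x)) \<partial>lborel)"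
    unfolding noise_moment_def using assms
    by (intro lborel_integral_real_affine[of "- 1 / s" _ "w / s"]) simp
  also have "\<dots> = \<bar>- 1 / s\<bar> *\<^sub>R
      (\<integral>x. std_normal_density ((w - x) / s) * ((w - x) / s) ^ j * e x \<partial>lborel)"
    using assms by (simp add: diff_divide_distrib algebra_simps)
  finally show ?thesis using assms by simp
qed

lemma integrable_noise_moment_affine:
  assumes "0 < s"
  shows "integrable lborel (\<lambda>x. std_normal_density ((w - x) / s) * ((w - x) / s) ^ j * e x / s)"
proof -
  have "integrable lborel (\<lambda>x. std_normal_density (w / s + (- 1 / s) * x)
      * (w / s + (- 1 / s) * x) ^ j * e (w - s * (w / s + (- 1 / s) * x)))"
    using lborel_integrable_real_affine[OF integrable_noise_moment[of j w s], of "- 1 / s" "w / s"] assms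
    by simp
  then have "integrable lborel (\<lambda>x. std_normal_density ((w - x) / s) * ((w - x) / s) ^ j * e x)"
    using assms by (simp add: diff_divide_distrib algebra_simps)
  then show ?thesis by simp
qed

lemma noise_moment_tendsto:
  assumes S: "S \<longlonglongrightarrow> s" and low: "0 < a" "\<And>n. a \<le> S n" and j: "j \<le> 1"
  shows "(\<lambda>n. noise_moment e j (S n) w) \<longlonglongrightarrow> noise_moment e j s w"
proof -
  have s: "a \<le> s" using LIMSEQ_le_const[OF S] low(2) by blast
  have pos: "0 < s" "\<And>n. 0 < S n" using s low by (auto intro: less_le_trans)
  have "(\<lambda>n. \<integral>x. std_normal_density ((w - x) / S n) * ((w - x) / S n) ^ j * e x / S n \<partial>lborel)
      \<longlonglongrightarrow> (\<integral>x. std_normal_density ((w - x) / s) * ((w - x) / s) ^ j * e x / s \<partial>lborel)"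
  proof (rule integral_dominated_convergence)
    show "integrable lborel (\<lambda>x. \<bar>e x\<bar> / a)" using integrable_e by simp
    show "AE x in lborel. (\<lambda>n. std_normal_density ((w - x) / S n) * ((w - x) / S n) ^ j * e x / S n)
        \<longlonglongrightarrow> std_normal_density ((w - x) / s) * ((w - x) / s) ^ j * e x / s"
      using pos S by (intro always_eventually allI tendsto_intros
          isCont_tendsto_compose[OF DERIV_isCont[OF std_normal_density_DERIV]]) auto
    fix n
    show "AE x in lborel. norm (std_normal_density ((w - x) / S n) * ((w - x) / S n) ^ j * e x / S n)
        \<le> \<bar>e x\<bar> / a"
    proof (intro always_eventually allI)
      fix x
      have "\<bar>std_normal_density ((w - x) / S n) * ((w - x) / S n) ^ j\<bar> * \<bar>e x\<bar> / S n \<le> 1 * \<bar>e x\<bar> / a"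
        using low pos by (intro frac_le mult_right_mono std_normal_density_moment_le_1 j) auto
      then show "norm (std_normal_density ((w - x) / S n) * ((w - x) / S n) ^ j * e x / S n) \<le> \<bar>e x\<bar> / a"
        using pos(2)[of n] by (simp add: abs_mult abs_divide)
    qed
  qed measurable
  then show ?thesis using pos by (simp add: noise_moment_affine)
qed

text \<open>
Tweedie's formula in unnormalised form: the derivative of the density of the observation is the
unnormalised conditional mean of the noise times \<open>- 1 / s\<close>.
\<close>

lemma noise_moment_DERIV:
  assumes "0 < s"
  shows "(noise_moment e 0 s has_real_derivative - noise_moment e 1 s w / s) (at w)"
  unfolding DERIV_def tendsto_at_iff_sequentially comp_def
proof (intro allI impI)
  fix H :: "nat \<Rightarrow> real" assume H: "\<forall>i. H i \<in> UNIV - {0}" "H \<longlonglongrightarrow> 0"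
  let ?q = "\<lambda>h x. (std_normal_density ((w + h - x) / s) - std_normal_density ((w - x) / s)) / h"
  have "(\<lambda>i. \<integral>x. ?q (H i) x * e x / s \<partial>lborel)
      \<longlonglongrightarrow> (\<integral>x. - (std_normal_density ((w - x) / s) * ((w - x) / s)) / s * e x / s \<partial>lborel)"
  proof (rule integral_dominated_convergence)
    show "integrable lborel (\<lambda>x. \<bar>e x\<bar> / s\<^sup>2)" using integrable_e by simp
    show "AE x in lborel. (\<lambda>i. ?q (H i) x * e x / s)
        \<longlonglongrightarrow> - (std_normal_density ((w - x) / s) * ((w - x) / s)) / s * e x / s"
    proof (intro always_eventually allI)
      fix x
      have "((\<lambda>w. std_normal_density ((w - x) / s)) has_real_derivative
          - (std_normal_density ((w - x) / s) * ((w - x) / s)) / s) (at w)"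
        using DERIV_chain2[OF std_normal_density_DERIV,
            OF DERIV_cdivide[OF DERIV_diff[OF DERIV_ident DERIV_const]], of x s w]
        by (simp add: DERIV_cdivide)
      then have "(\<lambda>i. ?q (H i) x) \<longlonglongrightarrow> - (std_normal_density ((w - x) / s) * ((w - x) / s)) / s"
        using H unfolding DERIV_def tendsto_at_iff_sequentially comp_def by auto
      then show "(\<lambda>i. ?q (H i) x * e x / s)
          \<longlonglongrightarrow> - (std_normal_density ((w - x) / s) * ((w - x) / s)) / s * e x / s"
        using assms by (intro tendsto_divide[OF tendsto_mult[OF _ tendsto_const] tendsto_const]) auto
    qed
    fix i
    show "AE x in lborel. norm (?q (H i) x * e x / s) \<le> \<bar>e x\<bar> / s\<^sup>2"
    proof (intro always_eventually allI)
      fix x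
      have "\<bar>std_normal_density ((w + H i - x) / s) - std_normal_density ((w - x) / s)\<bar>
          \<le> \<bar>(w + H i - x) / s - (w - x) / s\<bar>"
        by (rule std_normal_density_Lipschitz)
      also have "\<dots> = \<bar>H i\<bar> / s" using assms by (simp add: diff_divide_distrib[symmetric] abs_divide)
      finally have "\<bar>?q (H i) x\<bar> \<le> 1 / s"
        using H(1) assms by (simp add: abs_divide divide_le_eq)
      then have "\<bar>?q (H i) x\<bar> * (\<bar>e x\<bar> / s) \<le> 1 / s * (\<bar>e x\<bar> / s)"
        using assms by (intro mult_right_mono) auto
      then show "norm (?q (H i) x * e x / s) \<le> \<bar>e x\<bar> / s\<^sup>2"
        using assms by (simp add: abs_mult abs_divide power2_eq_square)
    qed
  qed measurable
  also have "(\<integral>x. - (std_normal_density ((w - x) / s) * ((w - x) / s)) / s * e x / s \<partial>lborel)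
      = - noise_moment e 1 s w / s"
    unfolding noise_moment_affine[OF assms]
    by (simp add: integral_divide_zero[symmetric] integral_minus[symmetric] algebra_simps
        del: integral_divide_zero integral_minus)
  also have "(\<lambda>i. \<integral>x. ?q (H i) x * e x / s \<partial>lborel)
      = (\<lambda>i. (noise_moment e 0 s (w + H i) - noise_moment e 0 s w) / H i)"
  proof
    fix i
    show "(\<integral>x. ?q (H i) x * e x / s \<partial>lborel)
        = (noise_moment e 0 s (w + H i) - noise_moment e 0 s w) / H i"
      unfolding noise_moment_affine[OF assms]
      apply (subst Bochner_Integration.integral_diff[symmetric])
        apply (rule integrable_noise_moment_affine[OF assms])+
      apply (subst integral_divide_zero[symmetric])
      apply (rule Bochner_Integration.integral_cong)
      using assms by (auto simp: field_simps)
  qed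
  finally show "(\<lambda>i. (noise_moment e 0 s (w + H i) - noise_moment e 0 s w) / H i)
      \<longlonglongrightarrow> - noise_moment e 1 s w / s" .
qed

lemma noise_moment_1_zero: "noise_moment e 1 0 w = 0"
  using integral_std_normal_moment_odd[of 0] by (simp add: noise_moment_def)

end

text \<open>
Measurable functions are almost everywhere limits of continuous ones. Clipping those to \<open>[0, 2 \<phi>]\<close>, where
\<open>\<phi>\<close> is the standard normal density, makes dominated convergence applicable.
\<close>

lemma (in gaussian_dominated) continuous_approximation:
  assumes "\<And>x. 0 \<le> e x" "0 < \<epsilon>"
  obtains k where "continuous_on UNIV k" "\<And>x. 0 \<le> k x" "\<And>x. k x \<le> 2 * std_normal_density x"
    "(\<integral>x. \<bar>e x - k x\<bar> \<partial>lborel) < \<epsilon>"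
proof -
  have "e measurable_on UNIV"
    by (rule lebesgue_measurable_imp_measurable_on_real) (simp_all add: measurable_completion)
  then obtain N g where N: "negligible N" and g: "\<And>n. continuous_on UNIV (g n)"
      and lim: "\<And>x. x \<notin> N \<Longrightarrow> (\<lambda>n. g n x) \<longlonglongrightarrow> e x"
    unfolding measurable_on_def by auto
  define k where "k n x = max 0 (min (2 * std_normal_density x) (g n x))" for n :: nat and x
  have phi: "continuous_on UNIV std_normal_density"
    using std_normal_density_DERIV by (intro DERIV_continuous_on) auto
  have k_cont: "continuous_on UNIV (k n)" for n
    unfolding k_def by (intro continuous_intros phi g)
  have [measurable]: "k n \<in> borel_measurable borel" for n
    using k_cont by (rule borel_measurable_continuous_onI)
  have k_bounds: "0 \<le> k n x" "k n x \<le> 2 * std_normal_density x" for n x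
    unfolding k_def by auto
  have "AE x in lebesgue. x \<notin> N"
    using N by (simp add: AE_not_in negligible_iff_null_sets)
  then have ae: "AE x in lborel. x \<notin> N"
    by (simp add: AE_completion_iff)
  have "(\<lambda>n. \<integral>x. \<bar>e x - k n x\<bar> \<partial>lborel) \<longlonglongrightarrow> (\<integral>x. \<bar>e x - e x\<bar> \<partial>(lborel :: real measure))"
  proof (rule integral_dominated_convergence)
    show "integrable lborel (\<lambda>x. 2 * std_normal_density x)" by simp
    show "AE x in lborel. (\<lambda>n. \<bar>e x - k n x\<bar>) \<longlonglongrightarrow> \<bar>e x - e x\<bar>"
      using ae
    proof eventually_elim
      fix x assume "x \<notin> N"
      have "(\<lambda>n. k n x) \<longlonglongrightarrow> max 0 (min (2 * std_normal_density x) (e x))"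
        unfolding k_def by (intro tendsto_intros lim \<open>x \<notin> N\<close>)
      also have "max 0 (min (2 * std_normal_density x) (e x)) = e x"
        using assms(1)[of x] dominated[of x] by simp
      finally show "(\<lambda>n. \<bar>e x - k n x\<bar>) \<longlonglongrightarrow> \<bar>e x - e x\<bar>"
        by (intro tendsto_intros)
    qed
    fix n
    show "AE x in lborel. norm \<bar>e x - k n x\<bar> \<le> 2 * std_normal_density x"
    proof (intro always_eventually allI)
      fix x show "norm \<bar>e x - k n x\<bar> \<le> 2 * std_normal_density x"
        using k_bounds[of n x] assms(1)[of x] dominated[of x] by simp
    qed
  qed measurable
  then have "(\<lambda>n. \<integral>x. \<bar>e x - k n x\<bar> \<partial>lborel) \<longlonglongrightarrow> 0" by simp
  from order_tendstoD(2)[OF this \<open>0 < \<epsilon>\<close>]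
  obtain n where "(\<integral>x. \<bar>e x - k n x\<bar> \<partial>lborel) < \<epsilon>"
    by (auto simp: eventually_sequentially)
  then show thesis using that k_cont k_bounds by blast
qed

lemma (in gaussian_dominated) integral_abs_noise_moment_tendsto_continuous:
  assumes cont: "continuous_on UNIV e" and S: "S \<longlonglongrightarrow> 0"
  shows "(\<lambda>n. \<integral>w. \<bar>noise_moment e 1 (S n) w\<bar> \<partial>lborel) \<longlonglongrightarrow> 0"
proof -
  obtain b where b: "\<And>n. (S n)\<^sup>2 \<le> b" using convergent_squares_bounded[OF S] by blast
  have pos: "0 < 1 + b" using b[of 0] zero_le_power2[of "S 0"] by linarith
  have pointwise: "(\<lambda>n. noise_moment e 1 (S n) w) \<longlonglongrightarrow> 0" for w
  proof -
    have "(\<lambda>n. \<integral>u. std_normal_density u * u ^ 1 * e (w - S n * u) \<partial>lborel)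
        \<longlonglongrightarrow> (\<integral>u. std_normal_density u * u ^ 1 * e (w - 0 * u) \<partial>lborel)"
    proof (rule integral_dominated_convergence)
      show "integrable lborel (\<lambda>u. exp (- w\<^sup>2 / (4 * (1 + b))) * (\<bar>u\<bar> ^ 1 * exp (- u\<^sup>2 / 4)))"
        using integrable_abs_moment by (rule integrable_mult_right)
      show "AE u in lborel. (\<lambda>n. std_normal_density u * u ^ 1 * e (w - S n * u))
          \<longlonglongrightarrow> std_normal_density u * u ^ 1 * e (w - 0 * u)"
        using cont by (intro always_eventually allI tendsto_mult tendsto_const
            isCont_tendsto_compose[of _ e] tendsto_diff S)
          (auto simp: continuous_on_eq_continuous_at)
      show "AE u in lborel. norm (std_normal_density u * u ^ 1 * e (w - S n * u))
          \<le> exp (- w\<^sup>2 / (4 * (1 + b))) * (\<bar>u\<bar> ^ 1 * exp (- u\<^sup>2 / 4))" for n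
        using integrand_bound[OF b, where j=1] by (intro always_eventually) simp
    qed measurable
    also have "(\<integral>u. std_normal_density u * u ^ 1 * e (w - 0 * u) \<partial>lborel) = 0"
      using noise_moment_1_zero unfolding noise_moment_def by simp
    finally show ?thesis unfolding noise_moment_def .
  qed
  have "(\<lambda>n. \<integral>w. \<bar>noise_moment e 1 (S n) w\<bar> \<partial>lborel) \<longlonglongrightarrow> (\<integral>w. \<bar>0\<bar> \<partial>(lborel :: real measure))"
  proof (rule integral_dominated_convergence)
    show "integrable lborel (\<lambda>w. abs_moment 1 * (\<bar>w\<bar> ^ 0 * exp (- w\<^sup>2 / (4 * (1 + b)))))"
      using pos by (intro integrable_mult_right integrable_gauss_quarter)
    show "AE w in lborel. (\<lambda>n. \<bar>noise_moment e 1 (S n) w\<bar>) \<longlonglongrightarrow> \<bar>0\<bar>"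
      by (intro always_eventually allI tendsto_rabs pointwise)
    show "AE w in lborel. norm \<bar>noise_moment e 1 (S n) w\<bar>
        \<le> abs_moment 1 * (\<bar>w\<bar> ^ 0 * exp (- w\<^sup>2 / (4 * (1 + b))))" for n
      using noise_moment_bound[OF b] by simp
  qed measurable
  then show ?thesis by simp
qed

locale gaussian_dominated_density = gaussian_dominated d for d +
  assumes nonneg_d: "\<And>x. 0 \<le> d x"
    and integral_d: "(\<integral>x. d x \<partial>lborel) = 1"
begin

text \<open>
As the noise level tends to \<open>0\<close>, the observation determines the signal and says nothing about the
independent noise. This needs the signal to have a density, and holds in mean rather than pointwise: a continuous
approximation of \<open>d\<close> is handled by dominated convergence, and its error contributes no more than its integral.
\<close>

lemma integral_abs_noise_moment_tendsto:
  assumes S: "S \<longlonglongrightarrow> 0"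
  shows "(\<lambda>n. \<integral>w. \<bar>noise_moment d 1 (S n) w\<bar> \<partial>lborel) \<longlonglongrightarrow> 0"
proof (rule LIMSEQ_I)
  fix r :: real assume "0 < r"
  then have "0 < r / 2" by simp
  obtain k where k: "continuous_on UNIV k" "\<And>x. 0 \<le> k x" "\<And>x. k x \<le> 2 * std_normal_density x"
      and close: "(\<integral>x. \<bar>d x - k x\<bar> \<partial>lborel) < r / 2"
    using continuous_approximation[OF nonneg_d \<open>0 < r / 2\<close>] by blast
  have [measurable]: "k \<in> borel_measurable borel"
    using k(1) by (rule borel_measurable_continuous_onI)
  interpret k: gaussian_dominated k
    by unfold_locales (use k in auto)
  interpret dk: gaussian_dominated "\<lambda>x. d x - k x"
  proof unfold_locales
    fix x show "\<bar>d x - k x\<bar> \<le> 2 * std_normal_density x"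
      using k(2,3)[of x] nonneg_d[of x] dominated[of x] by simp
  qed measurable
  have split: "noise_moment d 1 s w = noise_moment k 1 s w + noise_moment (\<lambda>x. d x - k x) 1 s w" for s w
    unfolding noise_moment_def
    by (subst Bochner_Integration.integral_add[symmetric,
          OF k.integrable_noise_moment dk.integrable_noise_moment]) (simp add: algebra_simps)
  from order_tendstoD(2)[OF k.integral_abs_noise_moment_tendsto_continuous[OF k(1) S] \<open>0 < r / 2\<close>]
  obtain n0 where n0: "\<And>n. n0 \<le> n \<Longrightarrow> (\<integral>w. \<bar>noise_moment k 1 (S n) w\<bar> \<partial>lborel) < r / 2"
    by (auto simp: eventually_sequentially)
  show "\<exists>n0. \<forall>n\<ge>n0. norm ((\<integral>w. \<bar>noise_moment d 1 (S n) w\<bar> \<partial>lborel) - 0) < r"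
  proof (intro exI allI impI)
    fix n assume "n0 \<le> n"
    have "(\<integral>w. \<bar>noise_moment d 1 (S n) w\<bar> \<partial>lborel)
        \<le> (\<integral>w. \<bar>noise_moment k 1 (S n) w\<bar> + \<bar>noise_moment (\<lambda>x. d x - k x) 1 (S n) w\<bar> \<partial>lborel)"
      unfolding split using k.integrable_noise_moment_outer dk.integrable_noise_moment_outer
      by (intro integral_mono) auto
    also have "\<dots> = (\<integral>w. \<bar>noise_moment k 1 (S n) w\<bar> \<partial>lborel)
        + (\<integral>w. \<bar>noise_moment (\<lambda>x. d x - k x) 1 (S n) w\<bar> \<partial>lborel)"
      using k.integrable_noise_moment_outer dk.integrable_noise_moment_outer
      by (intro Bochner_Integration.integral_add) auto
    also have "\<dots> < r / 2 + r / 2"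
      using n0[OF \<open>n0 \<le> n\<close>] dk.integral_abs_noise_moment_le[of "S n"] close by linarith
    finally show "norm ((\<integral>w. \<bar>noise_moment d 1 (S n) w\<bar> \<partial>lborel) - 0) < r"
      by (simp add: integral_nonneg_AE)
  qed
qed

lemma noise_moment_0_pos:
  assumes "0 < s"
  shows "0 < noise_moment d 0 s w"
proof -
  let ?f = "\<lambda>x. std_normal_density ((w - x) / s) * ((w - x) / s) ^ 0 * d x / s"
  have nonneg: "0 \<le> ?f x" for x using assms nonneg_d by simp
  have "noise_moment d 0 s w \<noteq> 0"
  proof
    assume "noise_moment d 0 s w = 0"
    then have "(\<integral>x. ?f x \<partial>lborel) = 0" using noise_moment_affine[OF assms] by simp
    then have "AE x in lborel. ?f x = 0"
      using integral_nonneg_eq_0_iff_AE[OF integrable_noise_moment_affine[OF assms], of w 0] nonneg by simp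
    then have "AE x in lborel. d x = 0"
    proof eventually_elim
      fix x assume "?f x = 0"
      then show "d x = 0" using assms normal_density_pos[of 1 0 "(w - x) / s"] by simp
    qed
    then have "(\<integral>x. d x \<partial>lborel) = 0" using integral_eq_zero_AE by blast
    then show False using integral_d by simp
  qed
  moreover have "0 \<le> noise_moment d 0 s w"
    unfolding noise_moment_affine[OF assms] using nonneg by (intro integral_nonneg_AE) simp
  ultimately show ?thesis by simp
qed

definition noise_estimate :: "real \<Rightarrow> real \<Rightarrow> real" where
  "noise_estimate s w = noise_moment d 1 s w / noise_moment d 0 s w"

lemma measurable_noise_estimate [measurable]: "noise_estimate s \<in> borel_measurable borel"
  unfolding noise_estimate_def[abs_def] by measurable

text \<open>
Jensen's inequality for the conditional law of the noise given \<open>w\<close>: integrate the tangent of \<open>u \<mapsto> u ^ j\<close> at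
the conditional mean.
\<close>

lemma noise_estimate_Jensen:
  assumes s: "0 < s" and tangent: "\<And>u. noise_estimate s w ^ j + D * (u - noise_estimate s w) \<le> u ^ j"
  shows "noise_estimate s w ^ j * noise_moment d 0 s w \<le> noise_moment d j s w"
proof -
  let ?g = "noise_estimate s w" and ?k = "\<lambda>i u. std_normal_density u * u ^ i * d (w - s * u)"
  have int: "integrable lborel (\<lambda>u. (?g ^ j - D * ?g) * ?k 0 u + D * ?k 1 u)"
    by (intro Bochner_Integration.integrable_add integrable_mult_right integrable_noise_moment)
  have mean: "noise_moment d 1 s w = ?g * noise_moment d 0 s w"
    using noise_moment_0_pos[OF s, of w] by (simp add: noise_estimate_def)
  have "?g ^ j * noise_moment d 0 s w = (?g ^ j - D * ?g) * noise_moment d 0 s w + D * noise_moment d 1 s w"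
    unfolding mean by (simp add: algebra_simps)
  also have "\<dots> = (\<integral>u. (?g ^ j - D * ?g) * ?k 0 u + D * ?k 1 u \<partial>lborel)"
    unfolding noise_moment_def
    by (subst Bochner_Integration.integral_add[OF
          integrable_mult_right[OF integrable_noise_moment] integrable_mult_right[OF integrable_noise_moment]])
      (simp only: integral_mult_right_zero)
  also have "\<dots> \<le> noise_moment d j s w"
    unfolding noise_moment_def
  proof (rule integral_mono[OF int integrable_noise_moment])
    fix u
    have "(?g ^ j + D * (u - ?g)) * (std_normal_density u * d (w - s * u))
        \<le> u ^ j * (std_normal_density u * d (w - s * u))"
      using nonneg_d by (intro mult_right_mono tangent) auto
    then show "(?g ^ j - D * ?g) * ?k 0 u + D * ?k 1 u \<le> ?k j u" by (simp add: algebra_simps)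
  qed
  finally show ?thesis .
qed

lemma noise_estimate_power2_le:
  assumes "0 < s"
  shows "(noise_estimate s w)\<^sup>2 * noise_moment d 0 s w \<le> noise_moment d 2 s w"
proof (rule noise_estimate_Jensen[OF assms])
  fix u
  have "0 \<le> (u - noise_estimate s w)\<^sup>2" by simp
  then show "(noise_estimate s w)\<^sup>2 + 2 * noise_estimate s w * (u - noise_estimate s w) \<le> u\<^sup>2"
    by (simp add: power2_eq_square algebra_simps)
qed

lemma noise_estimate_power4_le:
  assumes "0 < s"
  shows "noise_estimate s w ^ 4 * noise_moment d 0 s w \<le> noise_moment d 4 s w"
proof (rule noise_estimate_Jensen[OF assms])
  fix u
  let ?c = "noise_estimate s w"
  \<comment> \<open>The gap between \<open>u ^ 4\<close> and its tangent at \<open>?c\<close>, as a sum of squares.\<close>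
  have "u ^ 4 - ?c ^ 4 - 4 * ?c ^ 3 * (u - ?c) = (u - ?c)\<^sup>2 * ((u + ?c)\<^sup>2 + 2 * ?c\<^sup>2)"
    by algebra
  also have "0 \<le> \<dots>" by simp
  finally show "?c ^ 4 + 4 * ?c ^ 3 * (u - ?c) \<le> u ^ 4" by simp
qed

lemma noise_moment_0_nonneg: "0 \<le> noise_moment d 0 s w"
  unfolding noise_moment_def using nonneg_d by (intro integral_nonneg_AE) auto

text \<open>
This is \<open>E[E[G | W]\<^sup>2]\<close> for the observation \<open>W\<close> at noise level \<open>s\<close>, that is, \<open>s\<^sup>2\<close> times the Fisher
information of \<open>W\<close>. Unlike the Fisher information it extends to \<open>s = 0\<close>.
\<close>

definition noise_energy :: "real \<Rightarrow> real" where
  "noise_energy s = (\<integral>w. (noise_estimate s w)\<^sup>2 * noise_moment d 0 s w \<partial>lborel)"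

lemma noise_energy_integrand_bound:
  assumes "0 < s" "s\<^sup>2 \<le> b"
  shows "(noise_estimate s w)\<^sup>2 * noise_moment d 0 s w
    \<le> abs_moment 2 * (\<bar>w\<bar> ^ 0 * exp (- w\<^sup>2 / (4 * (1 + b))))"
  using noise_estimate_power2_le[OF assms(1), of w] noise_moment_bound[OF assms(2), of 2 w] by simp

lemma integrable_noise_energy:
  assumes "0 < s"
  shows "integrable lborel (\<lambda>w. (noise_estimate s w)\<^sup>2 * noise_moment d 0 s w)"
proof (rule Bochner_Integration.integrable_bound)
  show "integrable lborel (\<lambda>w. abs_moment 2 * (\<bar>w\<bar> ^ 0 * exp (- w\<^sup>2 / (4 * (1 + s\<^sup>2)))))"
    by (intro integrable_mult_right integrable_gauss_quarter) (simp add: add_pos_nonneg)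
  show "AE w in lborel. norm ((noise_estimate s w)\<^sup>2 * noise_moment d 0 s w)
      \<le> norm (abs_moment 2 * (\<bar>w\<bar> ^ 0 * exp (- w\<^sup>2 / (4 * (1 + s\<^sup>2)))))"
    using noise_energy_integrand_bound[OF assms order_refl] noise_moment_0_nonneg abs_moment_nonneg
    by (auto simp: abs_mult)
qed measurable

lemma noise_energy_0: "noise_energy 0 = 0"
  by (simp add: noise_energy_def noise_estimate_def noise_moment_1_zero del: One_nat_def)

lemma noise_energy_nonneg: "0 \<le> noise_energy s"
  unfolding noise_energy_def using noise_moment_0_nonneg by (intro integral_nonneg_AE) auto

text \<open>
The split \<open>g\<^sup>2 \<le> K \<bar>g\<bar> + g\<^sup>4 / K\<^sup>2\<close> bounds the second moment by the first, which tends to \<open>0\<close> with \<open>s\<close>, and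
the fourth, which stays bounded. The constant \<open>8\<close> is \<open>4 (1 + b)\<close> for noise levels with \<open>s\<^sup>2 \<le> b = 1\<close>.
\<close>

lemma noise_energy_truncation:
  assumes s: "0 < s" "s\<^sup>2 \<le> 1" and K: "0 < K"
  shows "noise_energy s \<le> K * (\<integral>w. \<bar>noise_moment d 1 s w\<bar> \<partial>lborel)
    + 1 / K\<^sup>2 * (abs_moment 4 * (\<integral>w. exp (- w\<^sup>2 / 8) \<partial>lborel))"
proof -
  have int: "integrable lborel (\<lambda>w::real. exp (- w\<^sup>2 / 8))"
    using integrable_gauss_quarter[of 2 0] by simp
  have "noise_energy s \<le> (\<integral>w. K * \<bar>noise_moment d 1 s w\<bar>
      + 1 / K\<^sup>2 * (abs_moment 4 * exp (- w\<^sup>2 / 8)) \<partial>lborel)"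
    unfolding noise_energy_def
  proof (rule integral_mono[OF integrable_noise_energy[OF s(1)]])
    show "integrable lborel (\<lambda>w. K * \<bar>noise_moment d 1 s w\<bar> + 1 / K\<^sup>2 * (abs_moment 4 * exp (- w\<^sup>2 / 8)))"
      using integrable_noise_moment_outer int
      by (intro Bochner_Integration.integrable_add integrable_mult_right) auto
    fix w
    let ?g = "noise_estimate s w" and ?P = "noise_moment d 0 s w"
    have mean: "\<bar>noise_moment d 1 s w\<bar> = \<bar>?g\<bar> * ?P"
      using noise_moment_0_pos[OF s(1), of w] by (simp add: noise_estimate_def)
    have "?g\<^sup>2 \<le> K * \<bar>?g\<bar> + ?g ^ 4 / K\<^sup>2"
    proof (cases "\<bar>?g\<bar> \<le> K")
      case True
      then have "\<bar>?g\<bar> * \<bar>?g\<bar> \<le> K * \<bar>?g\<bar>" by (intro mult_right_mono) auto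
      then have "?g\<^sup>2 \<le> K * \<bar>?g\<bar>" by (simp add: power2_eq_square)
      then show ?thesis using add_increasing2[of "?g ^ 4 / K\<^sup>2"] by simp
    next
      case False
      then have "K\<^sup>2 \<le> ?g\<^sup>2" using K by (simp add: abs_le_square_iff[symmetric])
      then have "?g\<^sup>2 * K\<^sup>2 \<le> ?g\<^sup>2 * ?g\<^sup>2" by (intro mult_left_mono) auto
      then have "?g\<^sup>2 \<le> ?g ^ 4 / K\<^sup>2" using K by (simp add: pos_le_divide_eq power2_eq_square power4_eq_xxxx)
      then show ?thesis using K by (simp add: add_increasing)
    qed
    then have "?g\<^sup>2 * ?P \<le> (K * \<bar>?g\<bar> + ?g ^ 4 / K\<^sup>2) * ?P"
      by (intro mult_right_mono noise_moment_0_nonneg)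
    also have "\<dots> = K * \<bar>noise_moment d 1 s w\<bar> + 1 / K\<^sup>2 * (?g ^ 4 * ?P)"
      unfolding mean by (simp add: algebra_simps)
    also have "\<dots> \<le> K * \<bar>noise_moment d 1 s w\<bar> + 1 / K\<^sup>2 * (abs_moment 4 * exp (- w\<^sup>2 / 8))"
      using noise_estimate_power4_le[OF s(1), of w] noise_moment_bound[OF s(2), of 4 w]
      by (intro add_left_mono mult_left_mono) auto
    finally show "?g\<^sup>2 * ?P \<le> K * \<bar>noise_moment d 1 s w\<bar> + 1 / K\<^sup>2 * (abs_moment 4 * exp (- w\<^sup>2 / 8))" .
  qed
  also have "\<dots> = K * (\<integral>w. \<bar>noise_moment d 1 s w\<bar> \<partial>lborel)
      + 1 / K\<^sup>2 * (abs_moment 4 * (\<integral>w. exp (- w\<^sup>2 / 8) \<partial>lborel))"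
    using integrable_noise_moment_outer int
    by (subst Bochner_Integration.integral_add) auto
  finally show ?thesis .
qed

lemma noise_energy_tendsto_0:
  assumes S: "S \<longlonglongrightarrow> 0" and pos: "\<And>n. 0 \<le> S n"
  shows "(\<lambda>n. noise_energy (S n)) \<longlonglongrightarrow> 0"
proof (rule LIMSEQ_I)
  fix r :: real assume r: "0 < r"
  define C where "C = abs_moment 4 * (\<integral>w. exp (- w\<^sup>2 / 8) \<partial>(lborel :: real measure))"
  have C: "0 \<le> C" unfolding C_def
    by (intro mult_nonneg_nonneg abs_moment_nonneg integral_nonneg_AE) auto
  \<comment> \<open>Large enough for the fourth moment term \<open>C / K\<^sup>2\<close> to be below \<open>r / 2\<close>.\<close>
  define K where "K = sqrt ((2 * C + 1) / r)"
  have K: "0 < K" and K2: "K\<^sup>2 = (2 * C + 1) / r" unfolding K_def using C r by simp_all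
  have tail: "1 / K\<^sup>2 * C < r / 2" unfolding K2 using C r by (simp add: field_simps)
  have "\<forall>\<^sub>F n in sequentially. (S n)\<^sup>2 < 1"
    using order_tendstoD(2)[OF tendsto_power[OF S, of 2], of 1] by simp
  moreover have "\<forall>\<^sub>F n in sequentially. (\<integral>w. \<bar>noise_moment d 1 (S n) w\<bar> \<partial>lborel) < r / (2 * K)"
    using order_tendstoD(2)[OF integral_abs_noise_moment_tendsto[OF S], of "r / (2 * K)"] r K by simp
  ultimately have "\<forall>\<^sub>F n in sequentially. norm (noise_energy (S n) - 0) < r"
  proof eventually_elim
    fix n
    assume small: "(S n)\<^sup>2 < 1" and int: "(\<integral>w. \<bar>noise_moment d 1 (S n) w\<bar> \<partial>lborel) < r / (2 * K)"
    show "norm (noise_energy (S n) - 0) < r"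
    proof (cases "S n = 0")
      case False
      then have "noise_energy (S n) \<le> K * (\<integral>w. \<bar>noise_moment d 1 (S n) w\<bar> \<partial>lborel) + 1 / K\<^sup>2 * C"
        using noise_energy_truncation[of "S n" K] pos[of n] small K unfolding C_def by simp
      also have "\<dots> < K * (r / (2 * K)) + r / 2"
        using int K tail by (intro add_strict_mono mult_strict_left_mono) auto
      also have "\<dots> = r" using K by simp
      finally show ?thesis using noise_energy_nonneg[of "S n"] by simp
    qed (use r noise_energy_0 in simp)
  qed
  then show "\<exists>n0. \<forall>n\<ge>n0. norm (noise_energy (S n) - 0) < r"
    by (simp add: eventually_sequentially)
qed

lemma noise_energy_tendsto_bounded_away:
  assumes S: "S \<longlonglongrightarrow> s" and low: "0 < a" "\<And>n. a \<le> S n"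
  shows "(\<lambda>n. noise_energy (S n)) \<longlonglongrightarrow> noise_energy s"
proof -
  have s: "0 < s" using LIMSEQ_le_const[OF S, of a] low by auto
  have pos: "0 < S n" for n using low(2)[of n] low(1) by linarith
  obtain b where b: "\<And>n. (S n)\<^sup>2 \<le> b" using convergent_squares_bounded[OF S] by blast
  have b_pos: "0 < 1 + b" using b[of 0] zero_le_power2[of "S 0"] by linarith
  show ?thesis unfolding noise_energy_def
  proof (rule integral_dominated_convergence)
    show "integrable lborel (\<lambda>w. abs_moment 2 * (\<bar>w\<bar> ^ 0 * exp (- w\<^sup>2 / (4 * (1 + b)))))"
      using b_pos by (intro integrable_mult_right integrable_gauss_quarter)
    show "AE w in lborel. (\<lambda>n. (noise_estimate (S n) w)\<^sup>2 * noise_moment d 0 (S n) w)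
        \<longlonglongrightarrow> (noise_estimate s w)\<^sup>2 * noise_moment d 0 s w"
      unfolding noise_estimate_def
    proof (intro always_eventually allI)
      fix w
      show "(\<lambda>n. (noise_moment d 1 (S n) w / noise_moment d 0 (S n) w)\<^sup>2 * noise_moment d 0 (S n) w)
          \<longlonglongrightarrow> (noise_moment d 1 s w / noise_moment d 0 s w)\<^sup>2 * noise_moment d 0 s w"
        using noise_moment_0_pos[OF s, of w]
        by (intro tendsto_mult tendsto_power tendsto_divide noise_moment_tendsto[OF S low]) auto
    qed
    show "AE w in lborel. norm ((noise_estimate (S n) w)\<^sup>2 * noise_moment d 0 (S n) w)
        \<le> abs_moment 2 * (\<bar>w\<bar> ^ 0 * exp (- w\<^sup>2 / (4 * (1 + b))))" for n
      using noise_energy_integrand_bound[OF pos b] noise_moment_0_nonneg by (auto simp: abs_mult)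
  qed measurable
qed

lemma continuous_on_noise_energy: "continuous_on {0..} noise_energy"
  unfolding continuous_on_sequentially comp_def
proof (intro allI ballI impI, elim conjE)
  fix S and s :: real assume s: "s \<in> {0..}" and pos: "\<forall>n. S n \<in> {0..}" and S: "S \<longlonglongrightarrow> s"
  show "(\<lambda>n. noise_energy (S n)) \<longlonglongrightarrow> noise_energy s"
  proof (cases "s = 0")
    case True
    then show ?thesis using noise_energy_tendsto_0[of S] S pos noise_energy_0 by simp
  next
    case False
    with s have "s / 2 < s" "0 < s / 2" by auto
    from order_tendstoD(1)[OF S this(1)]
    obtain n0 where n0: "\<And>n. n0 \<le> n \<Longrightarrow> s / 2 < S n" by (auto simp: eventually_sequentially)
    have "(\<lambda>n. noise_energy (S (n + n0))) \<longlonglongrightarrow> noise_energy s"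
      using n0 by (intro noise_energy_tendsto_bounded_away[OF LIMSEQ_ignore_initial_segment[OF S]
          \<open>0 < s / 2\<close>] less_imp_le) auto
    then show ?thesis by (rule LIMSEQ_offset)
  qed
qed

end

section \<open>The additive Gaussian channel\<close>

lemma Cauchy_Schwarz_integral:
  fixes f g :: "'a \<Rightarrow> real"
  assumes f: "integrable M (\<lambda>x. (f x)\<^sup>2)" and g: "integrable M (\<lambda>x. (g x)\<^sup>2)"
    and fg: "integrable M (\<lambda>x. f x * g x)"
  shows "(\<integral>x. f x * g x \<partial>M)\<^sup>2 \<le> (\<integral>x. (f x)\<^sup>2 \<partial>M) * (\<integral>x. (g x)\<^sup>2 \<partial>M)"
proof -
  define A B C where "A = (\<integral>x. (f x)\<^sup>2 \<partial>M)" and "B = (\<integral>x. f x * g x \<partial>M)" and "C = (\<integral>x. (g x)\<^sup>2 \<partial>M)"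
  have quad: "0 \<le> A - 2 * t * B + t\<^sup>2 * C" for t
  proof -
    have "0 \<le> (\<integral>x. (f x - t * g x)\<^sup>2 \<partial>M)" by simp
    also have "\<dots> = (\<integral>x. (f x)\<^sup>2 - 2 * t * (f x * g x) + t\<^sup>2 * (g x)\<^sup>2 \<partial>M)"
      by (intro Bochner_Integration.integral_cong refl) (simp add: power2_eq_square algebra_simps)
    also have "\<dots> = A - 2 * t * B + t\<^sup>2 * C"
      unfolding A_def B_def C_def using f g fg by simp
    finally show ?thesis .
  qed
  have "0 \<le> C" unfolding C_def by simp
  have "B\<^sup>2 \<le> A * C"
  proof (cases "C = 0")
    case True
    have "B = 0"
    proof (rule ccontr)
      assume "B \<noteq> 0"
      \<comment> \<open>At this \<open>t\<close> the quadratic, which is affine for \<open>C = 0\<close>, has the value \<open>- 1\<close>.\<close>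
      then show False using quad[of "(A + 1) / (2 * B)"] True by simp
    qed
    then show ?thesis using True by simp
  next
    case False
    with \<open>0 \<le> C\<close> have "0 < C" by simp
    have "A - 2 * (B / C) * B + (B / C)\<^sup>2 * C = A - B\<^sup>2 / C"
      using \<open>0 < C\<close> by (simp add: field_simps power2_eq_square)
    then have "B\<^sup>2 / C \<le> A" using quad[of "B / C"] by simp
    then show ?thesis using \<open>0 < C\<close> by (simp add: divide_le_eq)
  qed
  then show ?thesis unfolding A_def B_def C_def .
qed

text \<open>
The set where two continuous functions differ is open, and a nonempty open set has positive measure.
\<close>

lemma continuous_AE_lborel_eq:
  fixes p q :: "real \<Rightarrow> real"
  assumes "continuous_on UNIV p" "continuous_on UNIV q" and ae: "AE x in lborel. p x = q x"
  shows "p = q"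
proof -
  let ?N = "{x. p x \<noteq> q x}"
  have "open ?N" by (rule open_Collect_neq) (use assms in auto)
  moreover from \<open>open ?N\<close> have "?N \<in> null_sets lborel"
    using ae by (subst AE_iff_null_sets) auto
  then have "negligible ?N" by (simp add: negligible_iff_null_sets null_sets_completionI)
  ultimately have "?N = {}" using open_not_negligible by blast
  then show ?thesis by auto
qed

lemma (in prob_space) diff_density_eqI:
  assumes "\<And>h. 0 \<le> p h" and diff: "\<And>h. p differentiable (at h)"
    and dist: "distributed M lborel H (\<lambda>h. ennreal (p h))"
  shows "diff_density M H = p"
  unfolding diff_density_def
proof (rule the_equality)
  fix q
  assume q: "(\<forall>h. 0 \<le> q h) \<and> (\<forall>h. q differentiable (at h)) \<and>
    distributed M lborel H (\<lambda>h. ennreal (q h))"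
  have cont: "continuous_on UNIV r" if "\<And>h. r differentiable (at h)" for r :: "real \<Rightarrow> real"
    using that by (intro continuous_at_imp_continuous_on ballI differentiable_imp_continuous_within)
  have "AE x in lborel. ennreal (q x) = ennreal (p x)"
    using q dist by (intro distributed_unique) auto
  then have "AE x in lborel. q x = p x" using q assms(1) by simp
  then show "q = p" using q diff by (intro continuous_AE_lborel_eq cont) auto
qed (use assms in auto)

context gaussian_dominated_density
begin

text \<open>
For a signal \<open>X\<close> of unit second moment, \<open>E[X | W] = W - s E[G | W]\<close>, \<open>E[W\<^sup>2] = s\<^sup>2 + 1\<close> and
\<open>E[W E[G | W]] = s\<close>. Expanding the square shows that \<open>signal_energy\<close> is \<open>E[E[X | W]\<^sup>2]\<close>.
\<close>

definition signal_energy :: "real \<Rightarrow> real" where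
  "signal_energy s = 1 - s\<^sup>2 + s\<^sup>2 * noise_energy s"

text \<open>
The squared distance of \<open>E[G | W]\<close> from the line spanned by \<open>E[X | W]\<close>; the proof of \<open>correlation_bound\<close>
derives this closed form.
\<close>

definition residual_energy :: "real \<Rightarrow> real" where
  "residual_energy s = (s\<^sup>2 * noise_energy s + noise_energy s - s\<^sup>2) / signal_energy s"

end

locale gaussian_channel = prob_space M + gaussian_dominated_density d
  for M :: "'w measure" and d :: "real \<Rightarrow> real" +
  fixes G X :: "'w \<Rightarrow> real"
  assumes indep: "indep_var borel G borel X"
    and distr_G: "distributed M lborel G (\<lambda>x. ennreal (std_normal_density x))"
    and distr_X: "distributed M lborel X (\<lambda>x. ennreal (d x))"
    and integrable_X2: "integrable M (\<lambda>\<omega>. (X \<omega>)\<^sup>2)"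
    and expectation_X2: "expectation (\<lambda>\<omega>. (X \<omega>)\<^sup>2) = 1"
begin

lemma measurable_G [measurable]: "G \<in> borel_measurable M"
  and measurable_X [measurable]: "X \<in> borel_measurable M"
  using indep_var_rv1[OF indep] indep_var_rv2[OF indep] by auto

definition received :: "real \<Rightarrow> 'w \<Rightarrow> real" where
  "received s \<omega> = s * G \<omega> + X \<omega>"

lemma measurable_received [measurable]: "received s \<in> borel_measurable M"
  unfolding received_def[abs_def] by measurable

text \<open>
The map \<open>(u, x) \<mapsto> (u, s u + x)\<close> is a shear, so it preserves Lebesgue measure and turns the product density
of noise and signal into that of noise and observation.
\<close>

lemma joint_distribution:
  "distributed M (lborel \<Otimes>\<^sub>M lborel) (\<lambda>\<omega>. (G \<omega>, received s \<omega>))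
    (\<lambda>x. ennreal (std_normal_density (fst x) * d (snd x - s * fst x)))"
  unfolding distributed_def
proof (intro conjI)
  have indep': "indep_var lborel G lborel X"
    using indep unfolding indep_var_eq by simp
  have GX: "distributed M (lborel \<Otimes>\<^sub>M lborel) (\<lambda>\<omega>. (G \<omega>, X \<omega>))
      (\<lambda>(u, x). ennreal (std_normal_density u) * ennreal (d x))"
    by (rule distributed_joint_indep[OF _ _ distr_G distr_X indep']) unfold_locales
  show "distr M (lborel \<Otimes>\<^sub>M lborel) (\<lambda>\<omega>. (G \<omega>, received s \<omega>))
      = density (lborel \<Otimes>\<^sub>M lborel) (\<lambda>x. ennreal (std_normal_density (fst x) * d (snd x - s * fst x)))"
  proof (rule measure_eqI)
    fix A assume "A \<in> sets (distr M (lborel \<Otimes>\<^sub>M lborel) (\<lambda>\<omega>. (G \<omega>, received s \<omega>)))"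
    then have A[measurable]: "A \<in> sets (lborel \<Otimes>\<^sub>M lborel)" by simp
    have "emeasure (distr M (lborel \<Otimes>\<^sub>M lborel) (\<lambda>\<omega>. (G \<omega>, received s \<omega>))) A
        = (\<integral>\<^sup>+y. indicator A y \<partial>distr M (lborel \<Otimes>\<^sub>M lborel) (\<lambda>\<omega>. (G \<omega>, received s \<omega>)))"
      by (rule nn_integral_indicator[symmetric]) (use A in simp)
    also have "\<dots> = (\<integral>\<^sup>+\<omega>. indicator A (G \<omega>, received s \<omega>) \<partial>M)"
      by (rule nn_integral_distr) measurable
    also have "\<dots> = (\<integral>\<^sup>+\<omega>. (\<lambda>(u, x). indicator A (u, s * u + x)) (G \<omega>, X \<omega>) \<partial>M)"
      by (simp add: received_def)
    also have "\<dots> = (\<integral>\<^sup>+z. (\<lambda>(u, x). ennreal (std_normal_density u) * ennreal (d x)) z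
        * (\<lambda>(u, x). indicator A (u, s * u + x)) z \<partial>(lborel \<Otimes>\<^sub>M lborel))"
      by (rule distributed_nn_integral[OF GX, symmetric]) measurable
    also have "\<dots> = (\<integral>\<^sup>+u. \<integral>\<^sup>+x. ennreal (std_normal_density u) * ennreal (d x)
        * indicator A (u, s * u + x) \<partial>lborel \<partial>lborel)"
      by (subst lborel.nn_integral_fst[symmetric]) (simp_all add: case_prod_beta')
    also have "\<dots> = (\<integral>\<^sup>+u. \<integral>\<^sup>+w. ennreal (std_normal_density u * d (w - s * u)) * indicator A (u, w) \<partial>lborel \<partial>lborel)"
    proof (rule nn_integral_cong)
      fix u :: real
      show "(\<integral>\<^sup>+x. ennreal (std_normal_density u) * ennreal (d x) * indicator A (u, s * u + x) \<partial>lborel)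
          = (\<integral>\<^sup>+w. ennreal (std_normal_density u * d (w - s * u)) * indicator A (u, w) \<partial>lborel)"
        by (subst nn_integral_real_affine[where c=1 and t="- (s * u)"])
          (simp_all add: ennreal_mult nonneg_d)
    qed
    also have "\<dots> = (\<integral>\<^sup>+z. ennreal (std_normal_density (fst z) * d (snd z - s * fst z)) * indicator A z
        \<partial>(lborel \<Otimes>\<^sub>M lborel))"
      by (subst lborel.nn_integral_fst[symmetric]) simp_all
    also have "\<dots> = emeasure (density (lborel \<Otimes>\<^sub>M lborel)
        (\<lambda>x. ennreal (std_normal_density (fst x) * d (snd x - s * fst x)))) A"
      by (subst emeasure_density) (use A in simp_all)
    finally show "emeasure (distr M (lborel \<Otimes>\<^sub>M lborel) (\<lambda>\<omega>. (G \<omega>, received s \<omega>))) A = \<dots>" .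
  qed simp
qed measurable

lemma received_distribution:
  "distributed M lborel (received s) (\<lambda>w. ennreal (noise_moment d 0 s w))"
proof -
  have "distributed M lborel (received s)
      (\<lambda>w. \<integral>\<^sup>+u. ennreal (std_normal_density (fst (u, w)) * d (snd (u, w) - s * fst (u, w))) \<partial>lborel)"
    by (rule distr_marginal2[OF _ _ joint_distribution]) unfold_locales
  also have "(\<lambda>w. \<integral>\<^sup>+u. ennreal (std_normal_density (fst (u, w)) * d (snd (u, w) - s * fst (u, w))) \<partial>lborel)
      = (\<lambda>w. ennreal (noise_moment d 0 s w))"
  proof
    fix w
    show "(\<integral>\<^sup>+u. ennreal (std_normal_density (fst (u, w)) * d (snd (u, w) - s * fst (u, w))) \<partial>lborel)
        = ennreal (noise_moment d 0 s w)"
      unfolding noise_moment_def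
      using nn_integral_eq_integral[OF integrable_noise_moment[of 0 w s]] nonneg_d by simp
  qed
  finally show ?thesis .
qed

text \<open>
The defining property of the conditional expectation \<open>E[G | W]\<close>, read off from the joint density by Fubini's
theorem.
\<close>

lemma
  assumes s: "0 < s" and h [measurable]: "h \<in> borel_measurable borel"
    and int: "integrable M (\<lambda>\<omega>. G \<omega> * h (received s \<omega>))"
  shows integrable_noise_estimate: "integrable M (\<lambda>\<omega>. noise_estimate s (received s \<omega>) * h (received s \<omega>))"
    and expectation_noise_estimate: "expectation (\<lambda>\<omega>. G \<omega> * h (received s \<omega>))
      = expectation (\<lambda>\<omega>. noise_estimate s (received s \<omega>) * h (received s \<omega>))"
proof -
  let ?F = "\<lambda>u w. std_normal_density u * d (w - s * u) * (u * h w)"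
  have "integrable (lborel \<Otimes>\<^sub>M lborel) (\<lambda>x. std_normal_density (fst x) * d (snd x - s * fst x) * (fst x * h (snd x)))
      \<longleftrightarrow> integrable M (\<lambda>\<omega>. fst (G \<omega>, received s \<omega>) * h (snd (G \<omega>, received s \<omega>)))"
    by (rule distributed_integrable[OF joint_distribution]) (auto simp: nonneg_d)
  with int have int2: "integrable (lborel \<Otimes>\<^sub>M lborel) (\<lambda>(u, w). ?F u w)"
    by (simp add: case_prod_beta')
  have "(\<integral>x. std_normal_density (fst x) * d (snd x - s * fst x) * (fst x * h (snd x)) \<partial>(lborel \<Otimes>\<^sub>M lborel))
      = expectation (\<lambda>\<omega>. fst (G \<omega>, received s \<omega>) * h (snd (G \<omega>, received s \<omega>)))"
    by (rule distributed_integral[OF joint_distribution]) (auto simp: nonneg_d)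
  then have "expectation (\<lambda>\<omega>. G \<omega> * h (received s \<omega>)) = (\<integral>w. \<integral>u. ?F u w \<partial>lborel \<partial>lborel)"
    using lborel_pair.integral_snd[OF int2] by (simp add: case_prod_beta')
  moreover have inner: "(\<integral>u. ?F u w \<partial>lborel) = noise_moment d 0 s w * (noise_estimate s w * h w)" for w
  proof -
    have "(\<integral>u. ?F u w \<partial>lborel) = (\<integral>u. h w * (std_normal_density u * u ^ 1 * d (w - s * u)) \<partial>lborel)"
      by (intro Bochner_Integration.integral_cong refl) simp
    also have "\<dots> = h w * noise_moment d 1 s w"
      unfolding noise_moment_def by (rule integral_mult_right_zero)
    also have "\<dots> = noise_moment d 0 s w * (noise_estimate s w * h w)"
      using noise_moment_0_pos[OF s, of w] by (simp add: noise_estimate_def)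
    finally show ?thesis .
  qed
  ultimately have eq: "expectation (\<lambda>\<omega>. G \<omega> * h (received s \<omega>))
      = (\<integral>w. noise_moment d 0 s w * (noise_estimate s w * h w) \<partial>lborel)" by simp
  also have "\<dots> = expectation (\<lambda>\<omega>. noise_estimate s (received s \<omega>) * h (received s \<omega>))"
    by (rule distributed_integral[OF received_distribution]) (auto simp: noise_moment_0_nonneg)
  finally show "expectation (\<lambda>\<omega>. G \<omega> * h (received s \<omega>))
      = expectation (\<lambda>\<omega>. noise_estimate s (received s \<omega>) * h (received s \<omega>))" .
  have "integrable lborel (\<lambda>w. noise_moment d 0 s w * (noise_estimate s w * h w))"
    using lborel_pair.integrable_snd[OF int2] unfolding inner .
  moreover have "integrable lborel (\<lambda>w. noise_moment d 0 s w * (noise_estimate s w * h w))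
      \<longleftrightarrow> integrable M (\<lambda>\<omega>. noise_estimate s (received s \<omega>) * h (received s \<omega>))"
    by (rule distributed_integrable[OF received_distribution]) (auto simp: noise_moment_0_nonneg)
  ultimately show "integrable M (\<lambda>\<omega>. noise_estimate s (received s \<omega>) * h (received s \<omega>))" by simp
qed

lemma
  assumes s: "0 < s"
  shows integrable_noise_estimate_square: "integrable M (\<lambda>\<omega>. (noise_estimate s (received s \<omega>))\<^sup>2)"
    and expectation_noise_estimate_square:
      "expectation (\<lambda>\<omega>. (noise_estimate s (received s \<omega>))\<^sup>2) = noise_energy s"
proof -
  have "integrable lborel (\<lambda>w. noise_moment d 0 s w * (noise_estimate s w)\<^sup>2)
      \<longleftrightarrow> integrable M (\<lambda>\<omega>. (noise_estimate s (received s \<omega>))\<^sup>2)"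
    by (rule distributed_integrable[OF received_distribution]) (auto simp: noise_moment_0_nonneg)
  then show "integrable M (\<lambda>\<omega>. (noise_estimate s (received s \<omega>))\<^sup>2)"
    using integrable_noise_energy[OF s] by (simp add: mult.commute)
  have "(\<integral>w. noise_moment d 0 s w * (noise_estimate s w)\<^sup>2 \<partial>lborel)
      = expectation (\<lambda>\<omega>. (noise_estimate s (received s \<omega>))\<^sup>2)"
    by (rule distributed_integral[OF received_distribution]) (auto simp: noise_moment_0_nonneg)
  then show "expectation (\<lambda>\<omega>. (noise_estimate s (received s \<omega>))\<^sup>2) = noise_energy s"
    unfolding noise_energy_def by (simp add: mult.commute)
qed

lemma fisher_info_received:
  assumes s: "0 < s"
  shows "fisher_info M (received s) = noise_energy s / s\<^sup>2"
proof -
  have dens: "diff_density M (received s) = noise_moment d 0 s"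
    using noise_moment_DERIV[OF s]
    by (intro diff_density_eqI noise_moment_0_nonneg received_distribution)
      (auto simp: real_differentiable_def)
  have "score M (received s) w = - noise_estimate s w / s" for w
    unfolding score_def dens DERIV_imp_deriv[OF noise_moment_DERIV[OF s]] noise_estimate_def by simp
  then have "fisher_info M (received s) = expectation (\<lambda>\<omega>. (noise_estimate s (received s \<omega>))\<^sup>2 / s\<^sup>2)"
    unfolding fisher_info_def by (simp add: power_divide)
  also have "\<dots> = noise_energy s / s\<^sup>2"
    using expectation_noise_estimate_square[OF s] by simp
  finally show ?thesis .
qed

lemma integrable_G2: "integrable M (\<lambda>\<omega>. (G \<omega>)\<^sup>2)"
  and expectation_G2: "expectation (\<lambda>\<omega>. (G \<omega>)\<^sup>2) = 1"
proof -
  have "integrable lborel (\<lambda>x. std_normal_density x * x\<^sup>2) \<longleftrightarrow> integrable M (\<lambda>\<omega>. (G \<omega>)\<^sup>2)"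
    by (rule distributed_integrable[OF distr_G]) auto
  then show "integrable M (\<lambda>\<omega>. (G \<omega>)\<^sup>2)" using integrable_std_normal_moment[of 2] by simp
  have "(\<integral>x. std_normal_density x * x\<^sup>2 \<partial>lborel) = expectation (\<lambda>\<omega>. (G \<omega>)\<^sup>2)"
    by (rule distributed_integral[OF distr_G]) auto
  then show "expectation (\<lambda>\<omega>. (G \<omega>)\<^sup>2) = 1" using integral_std_normal_moment_even[of 1] by simp
qed

lemma integrable_GX: "integrable M (\<lambda>\<omega>. G \<omega> * X \<omega>)"
  and expectation_GX: "expectation (\<lambda>\<omega>. G \<omega> * X \<omega>) = 0"
proof -
  have G: "integrable M G" using square_integrable_imp_integrable[OF measurable_G integrable_G2] .
  have X: "integrable M X" using square_integrable_imp_integrable[OF measurable_X integrable_X2] .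
  show "integrable M (\<lambda>\<omega>. G \<omega> * X \<omega>)" by (rule indep_var_integrable[OF indep G X])
  have "(\<integral>x. std_normal_density x * x \<partial>lborel) = expectation G"
    by (rule distributed_integral[OF distr_G]) auto
  then have "expectation G = 0" using integral_std_normal_moment_odd[of 0] by simp
  then show "expectation (\<lambda>\<omega>. G \<omega> * X \<omega>) = 0"
    using indep_var_lebesgue_integral[OF indep G X] by simp
qed

lemma integrable_received_square: "integrable M (\<lambda>\<omega>. (received s \<omega>)\<^sup>2)"
  and expectation_received_square: "expectation (\<lambda>\<omega>. (received s \<omega>)\<^sup>2) = s\<^sup>2 + 1"
proof -
  have eq: "(\<lambda>\<omega>. (received s \<omega>)\<^sup>2) = (\<lambda>\<omega>. s\<^sup>2 * (G \<omega>)\<^sup>2 + 2 * s * (G \<omega> * X \<omega>) + (X \<omega>)\<^sup>2)"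
    by (simp add: received_def power2_eq_square algebra_simps)
  show "integrable M (\<lambda>\<omega>. (received s \<omega>)\<^sup>2)" unfolding eq
    using integrable_G2 integrable_GX integrable_X2 by simp
  show "expectation (\<lambda>\<omega>. (received s \<omega>)\<^sup>2) = s\<^sup>2 + 1" unfolding eq
    using integrable_G2 integrable_GX integrable_X2
    by (simp add: expectation_G2 expectation_GX expectation_X2)
qed

lemma
  assumes s: "0 < s"
  shows integrable_noise_estimate_received: "integrable M (\<lambda>\<omega>. noise_estimate s (received s \<omega>) * received s \<omega>)"
    and expectation_noise_estimate_received:
      "expectation (\<lambda>\<omega>. noise_estimate s (received s \<omega>) * received s \<omega>) = s"
proof -
  have eq: "(\<lambda>\<omega>. G \<omega> * received s \<omega>) = (\<lambda>\<omega>. s * (G \<omega>)\<^sup>2 + G \<omega> * X \<omega>)"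
    by (simp add: received_def power2_eq_square algebra_simps)
  have int: "integrable M (\<lambda>\<omega>. G \<omega> * received s \<omega>)"
    unfolding eq using integrable_G2 integrable_GX by simp
  have "expectation (\<lambda>\<omega>. G \<omega> * received s \<omega>) = s"
    unfolding eq using integrable_G2 integrable_GX by (simp add: expectation_G2 expectation_GX)
  then show "integrable M (\<lambda>\<omega>. noise_estimate s (received s \<omega>) * received s \<omega>)"
    "expectation (\<lambda>\<omega>. noise_estimate s (received s \<omega>) * received s \<omega>) = s"
    using integrable_noise_estimate[OF s, of "\<lambda>w. w"] expectation_noise_estimate[OF s, of "\<lambda>w. w"] int
    by simp_all
qed

text \<open>
Cauchy-Schwarz applied to \<open>E[W E[G | W]] = s\<close> gives \<open>s\<^sup>2 \<le> J (s\<^sup>2 + 1)\<close> for the noise energy \<open>J\<close>, hence a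
signal energy of at least \<open>1 / (1 + s\<^sup>2)\<close>.
\<close>

lemma signal_energy_pos: 
  assumes "0 \<le> s"
  shows "0 < signal_energy s"
proof (cases "s = 0")
  case False
  with assms have s: "0 < s" by simp
  let ?J = "noise_energy s"
  have "s\<^sup>2 \<le> ?J * (s\<^sup>2 + 1)"
    using Cauchy_Schwarz_integral[OF integrable_noise_estimate_square[OF s] integrable_received_square
        integrable_noise_estimate_received[OF s]]
    unfolding expectation_noise_estimate_received[OF s] expectation_noise_estimate_square[OF s]
      expectation_received_square .
  then have "s\<^sup>2 * s\<^sup>2 \<le> s\<^sup>2 * (?J * (s\<^sup>2 + 1))" by (intro mult_left_mono) auto
  then have "1 \<le> (1 + s\<^sup>2) * signal_energy s"
    unfolding signal_energy_def by (simp add: algebra_simps)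
  then have "0 < (1 + s\<^sup>2) * signal_energy s" by linarith
  moreover have "0 < 1 + s\<^sup>2" by (simp add: add_pos_nonneg)
  ultimately show ?thesis by (rule zero_less_mult_pos)
qed (simp add: signal_energy_def)

lemma continuous_on_residual_energy: "continuous_on {0..} residual_energy"
  unfolding residual_energy_def signal_energy_def
  by (intro continuous_intros continuous_on_noise_energy)
    (use signal_energy_pos in \<open>force simp: signal_energy_def\<close>)

lemma residual_energy_0: "residual_energy 0 = 0"
  by (simp add: residual_energy_def noise_energy_0)

text \<open>
A statistic of the observation that is uncorrelated with the signal sees only the part of \<open>E[G | W]\<close> orthogonal
to \<open>E[X | W]\<close>: adding a multiple \<open>c E[X | W]\<close> to \<open>E[G | W]\<close> does not change the correlation with the
statistic, and Cauchy-Schwarz is applied with the \<open>c\<close> that makes the sum shortest.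
\<close>

lemma correlation_bound:
  assumes s: "0 < s" and h [measurable]: "h \<in> borel_measurable borel"
    and Gh: "integrable M (\<lambda>\<omega>. G \<omega> * h (received s \<omega>))"
    and Xh: "integrable M (\<lambda>\<omega>. X \<omega> * h (received s \<omega>))"
    and h2: "integrable M (\<lambda>\<omega>. (h (received s \<omega>))\<^sup>2)"
    and uncorrelated: "expectation (\<lambda>\<omega>. X \<omega> * h (received s \<omega>)) = 0"
  shows "(expectation (\<lambda>\<omega>. G \<omega> * h (received s \<omega>)))\<^sup>2
    \<le> residual_energy s * expectation (\<lambda>\<omega>. (h (received s \<omega>))\<^sup>2)"
proof -
  let ?J = "noise_energy s" and ?W = "received s"
  let ?g = "\<lambda>\<omega>. noise_estimate s (?W \<omega>)" and ?h = "\<lambda>\<omega>. h (?W \<omega>)"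
  \<comment> \<open>The minimiser of the quadratic \<open>c \<mapsto> J + 2 c s (1 - J) + c\<^sup>2 signal_energy s\<close>,
    which is the expectation of \<open>z\<^sup>2\<close>.\<close>
  define c where "c = - (s * (1 - ?J)) / signal_energy s"
  let ?z = "\<lambda>\<omega>. ?g \<omega> + c * (?W \<omega> - s * ?g \<omega>)"
  note gh = integrable_noise_estimate[OF s h Gh]
  note Egh = expectation_noise_estimate[OF s h Gh]
  have Wh_eq: "(\<lambda>\<omega>. ?W \<omega> * ?h \<omega>) = (\<lambda>\<omega>. s * (G \<omega> * ?h \<omega>) + X \<omega> * ?h \<omega>)"
    by (simp add: received_def algebra_simps)
  have Wh: "integrable M (\<lambda>\<omega>. ?W \<omega> * ?h \<omega>)" unfolding Wh_eq using Gh Xh by simp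
  have EWh: "expectation (\<lambda>\<omega>. ?W \<omega> * ?h \<omega>) = s * expectation (\<lambda>\<omega>. G \<omega> * ?h \<omega>)"
    unfolding Wh_eq using Gh Xh uncorrelated by simp
  have zh_eq: "(\<lambda>\<omega>. ?z \<omega> * ?h \<omega>) = (\<lambda>\<omega>. (1 - c * s) * (?g \<omega> * ?h \<omega>) + c * (?W \<omega> * ?h \<omega>))"
    by (simp add: algebra_simps)
  have zh: "integrable M (\<lambda>\<omega>. ?z \<omega> * ?h \<omega>)" unfolding zh_eq using gh Wh by simp
  have "expectation (\<lambda>\<omega>. ?z \<omega> * ?h \<omega>)
      = (1 - c * s) * expectation (\<lambda>\<omega>. ?g \<omega> * ?h \<omega>) + c * expectation (\<lambda>\<omega>. ?W \<omega> * ?h \<omega>)"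
    unfolding zh_eq using gh Wh by simp
  also have "\<dots> = expectation (\<lambda>\<omega>. G \<omega> * ?h \<omega>)"
    unfolding EWh Egh[symmetric] by (simp add: algebra_simps)
  finally have Ezh: "expectation (\<lambda>\<omega>. ?z \<omega> * ?h \<omega>) = expectation (\<lambda>\<omega>. G \<omega> * ?h \<omega>)" .
  have z2_eq: "(\<lambda>\<omega>. (?z \<omega>)\<^sup>2) = (\<lambda>\<omega>. (1 - c * s)\<^sup>2 * (?g \<omega>)\<^sup>2
      + 2 * c * (1 - c * s) * (?g \<omega> * ?W \<omega>) + c\<^sup>2 * (?W \<omega>)\<^sup>2)"
    by (rule ext) algebra
  have z2: "integrable M (\<lambda>\<omega>. (?z \<omega>)\<^sup>2)"
    unfolding z2_eq using integrable_noise_estimate_square[OF s] integrable_received_square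
      integrable_noise_estimate_received[OF s] by simp
  have "expectation (\<lambda>\<omega>. (?z \<omega>)\<^sup>2) = (1 - c * s)\<^sup>2 * ?J + 2 * c * (1 - c * s) * s + c\<^sup>2 * (s\<^sup>2 + 1)"
    unfolding z2_eq using integrable_noise_estimate_square[OF s] integrable_received_square
      integrable_noise_estimate_received[OF s]
    by (simp add: expectation_noise_estimate_square[OF s] expectation_received_square
        expectation_noise_estimate_received[OF s])
  also have "\<dots> = ?J + 2 * c * (s * (1 - ?J)) + c\<^sup>2 * signal_energy s"
    unfolding signal_energy_def by algebra
  also have "\<dots> = ?J - (s * (1 - ?J))\<^sup>2 / signal_energy s"
    unfolding c_def using signal_energy_pos[of s] s by (simp add: field_simps power2_eq_square)
  also have "\<dots> = residual_energy s"
  proof -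
    have "?J * signal_energy s - (s * (1 - ?J))\<^sup>2 = s\<^sup>2 * ?J + ?J - s\<^sup>2"
      unfolding signal_energy_def by algebra
    then show ?thesis unfolding residual_energy_def using signal_energy_pos[of s] s by (simp add: field_simps)
  qed
  finally have "expectation (\<lambda>\<omega>. (?z \<omega>)\<^sup>2) = residual_energy s" .
  then show ?thesis using Cauchy_Schwarz_integral[OF z2 h2 zh] unfolding Ezh by simp
qed

end

section \<open>The law of the signed signal\<close>

text \<open>
The product lies in a set only if \<open>S\<close> or \<open>-S\<close> does, and both are standard normal. So its law is at most twice
the normal law, which gives the density and the bound whatever the dependence of \<open>Y\<close> on \<open>S\<close>.
\<close>

lemma (in prob_space) signed_gaussian_density:
  assumes S: "distributed M lborel S (\<lambda>x. ennreal (std_normal_density x))"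
    and Y [measurable]: "Y \<in> borel_measurable M" and sign: "\<And>\<omega>. Y \<omega> \<in> {-1, 1}"
  obtains d where "d \<in> borel_measurable borel" "\<And>x. 0 \<le> d x" "\<And>x. d x \<le> 2 * std_normal_density x"
    "distributed M lborel (\<lambda>\<omega>. S \<omega> * Y \<omega>) (\<lambda>x. ennreal (d x))"
proof -
  have S_meas [measurable]: "S \<in> borel_measurable M"
    using distributed_measurable[OF S] by simp
  have S': "distributed M lborel (\<lambda>\<omega>. - S \<omega>) (\<lambda>x. ennreal (std_normal_density x))"
    using normal_density_affine[OF S, of "-1" 0] by simp
  let ?X = "\<lambda>\<omega>. S \<omega> * Y \<omega>"
  let ?N = "distr M lborel ?X"
  have bound: "emeasure ?N A \<le> (\<integral>\<^sup>+x. ennreal (2 * std_normal_density x) * indicator A x \<partial>lborel)"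
    if A: "A \<in> sets lborel" for A
  proof -
    have [measurable]: "A \<in> sets borel" using A by simp
    let ?I = "\<integral>\<^sup>+x. ennreal (std_normal_density x) * indicator A x \<partial>lborel"
    have "emeasure ?N A = emeasure M (?X -` A \<inter> space M)"
      by (intro emeasure_distr) (use A in auto)
    also have "\<dots> \<le> emeasure M ((S -` A \<inter> space M) \<union> ((\<lambda>\<omega>. - S \<omega>) -` A \<inter> space M))"
    proof (rule emeasure_mono)
      show "?X -` A \<inter> space M \<subseteq> (S -` A \<inter> space M) \<union> ((\<lambda>\<omega>. - S \<omega>) -` A \<inter> space M)"
      proof
        fix \<omega> assume "\<omega> \<in> ?X -` A \<inter> space M"
        then show "\<omega> \<in> (S -` A \<inter> space M) \<union> ((\<lambda>\<omega>. - S \<omega>) -` A \<inter> space M)"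
          using sign[of \<omega>] by auto
      qed
    qed measurable
    also have "\<dots> \<le> emeasure M (S -` A \<inter> space M) + emeasure M ((\<lambda>\<omega>. - S \<omega>) -` A \<inter> space M)"
      by (rule emeasure_subadditive) measurable
    also have "\<dots> = ?I + ?I"
      using distributed_emeasure[OF S A] distributed_emeasure[OF S' A] by simp
    also have "\<dots> = (\<integral>\<^sup>+x. ennreal (std_normal_density x) * indicator A x
        + ennreal (std_normal_density x) * indicator A x \<partial>lborel)"
      by (rule nn_integral_add[symmetric]) measurable
    also have "\<dots> = (\<integral>\<^sup>+x. ennreal (2 * std_normal_density x) * indicator A x \<partial>lborel)"
      by (intro nn_integral_cong) (simp add: distrib_right[symmetric] ennreal_plus[symmetric] del: ennreal_plus)
    finally show ?thesis .
  qed
  have "absolutely_continuous lborel ?N"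
    unfolding absolutely_continuous_def
  proof
    fix A :: "real set" assume A: "A \<in> null_sets lborel"
    have "(\<integral>\<^sup>+x. ennreal (2 * std_normal_density x) * indicator A x \<partial>lborel) = 0"
      using A by (rule nn_integral_null_set)
    then show "A \<in> null_sets ?N" using bound[of A] A by (auto simp: null_sets_def)
  qed
  then obtain r where r [measurable]: "r \<in> borel_measurable lborel" and dens: "density lborel r = ?N"
    using sigma_finite_measure.Radon_Nikodym[OF lborel.sigma_finite_measure_axioms, of ?N] by auto
  let ?A = "{x. ennreal (2 * std_normal_density x) < r x}"
  have A: "?A \<in> sets lborel" by measurable
  \<comment> \<open>Otherwise the law would give \<open>?A\<close> more mass than twice the normal law does.\<close>
  have "AE x in lborel. r x * indicator ?A x \<le> ennreal (2 * std_normal_density x) * indicator ?A x"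
  proof (rule ccontr)
    assume "\<not> ?thesis"
    then have "(\<integral>\<^sup>+x. ennreal (2 * std_normal_density x) * indicator ?A x \<partial>lborel)
        < (\<integral>\<^sup>+x. r x * indicator ?A x \<partial>lborel)"
    proof (rule nn_integral_less[rotated 4])
      have "(\<integral>\<^sup>+x. ennreal (2 * std_normal_density x) * indicator ?A x \<partial>lborel)
          \<le> (\<integral>\<^sup>+x. ennreal (2 * std_normal_density x) \<partial>lborel)"
        by (intro nn_integral_mono) (auto split: split_indicator)
      also have "\<dots> = ennreal 2" by (simp add: nn_integral_eq_integral)
      finally show "(\<integral>\<^sup>+x. ennreal (2 * std_normal_density x) * indicator ?A x \<partial>lborel) \<noteq> \<infinity>"
        by (auto simp: top_unique)
    qed (auto split: split_indicator)
    also have "(\<integral>\<^sup>+x. r x * indicator ?A x \<partial>lborel) = emeasure ?N ?A"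
      unfolding dens[symmetric] by (rule emeasure_density[symmetric, OF r A])
    finally show False using bound[OF A] by simp
  qed
  then have r_le: "AE x in lborel. r x \<le> ennreal (2 * std_normal_density x)"
    by eventually_elim (auto split: split_indicator_asm)
  define d where "d x = min (enn2real (r x)) (2 * std_normal_density x)" for x
  have d_meas [measurable]: "d \<in> borel_measurable borel" unfolding d_def by measurable
  have "AE x in lborel. ennreal (d x) = r x"
    using r_le
  proof eventually_elim
    fix x assume le: "r x \<le> ennreal (2 * std_normal_density x)"
    then have "r x < \<top>" by (rule le_less_trans) simp
    moreover have "enn2real (r x) \<le> 2 * std_normal_density x" using le by (intro enn2real_leI) auto
    ultimately show "ennreal (d x) = r x" by (simp add: d_def)
  qed
  then have "density lborel (\<lambda>x. ennreal (d x)) = ?N"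
    unfolding dens[symmetric] by (intro density_cong) auto
  then have "distributed M lborel ?X (\<lambda>x. ennreal (d x))"
    unfolding distributed_def by auto
  moreover have "0 \<le> d x" "d x \<le> 2 * std_normal_density x" for x unfolding d_def by auto
  ultimately show thesis using that d_meas by blast
qed

lemma (in prob_space) gaussian_model_label_measurable:
  assumes model: "gaussian_model M \<nu> G S U" and label: "label_function f"
    and Y: "\<And>\<omega>. Y \<omega> = f (S \<omega>) (U \<omega>)"
  shows "Y \<in> borel_measurable M"
proof -
  have indep: "indep_vars (\<lambda>_. borel) ((!) [G, S, U]) {..<3}"
    using model unfolding gaussian_model_def by auto
  have [measurable]: "(\<lambda>(s, u). f s u) \<in> borel_measurable (borel \<Otimes>\<^sub>M borel)"
    using label unfolding label_function_def by auto
  have [measurable]: "S \<in> borel_measurable M" "U \<in> borel_measurable M"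
  proof -
    have rv: "\<forall>i\<in>{..<3::nat}. ([G, S, U] ! i) \<in> borel_measurable M"
      using indep unfolding indep_vars_def by blast
    show "S \<in> borel_measurable M" using bspec[OF rv, of 1] by simp
    show "U \<in> borel_measurable M" using bspec[OF rv, of 2] by (simp add: numeral_2_eq_2)
  qed
  have "(\<lambda>\<omega>. (\<lambda>(s, u). f s u) (S \<omega>, U \<omega>)) \<in> borel_measurable M" by measurable
  moreover have "(\<lambda>\<omega>. (\<lambda>(s, u). f s u) (S \<omega>, U \<omega>)) = Y" by (simp add: fun_eq_iff Y)
  ultimately show ?thesis by (simp only:)
qed

text \<open>
A sign change of the noise keeps the density \<open>d\<close> of the signal, so both channels have the same energies. It
accounts for a negative \<open>\<mu>\<close>.
\<close>

lemma (in prob_space) gaussian_model_channel: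
  assumes model: "gaussian_model M \<nu> G S U" and label: "label_function f"
    and Y: "\<And>\<omega>. Y \<omega> = f (S \<omega>) (U \<omega>)"
  obtains d where "\<And>\<epsilon>. \<epsilon> \<in> {-1, 1} \<Longrightarrow> gaussian_channel M d (\<lambda>\<omega>. \<epsilon> * G \<omega>) (\<lambda>\<omega>. S \<omega> * Y \<omega>)"
proof -
  have indep3: "indep_vars (\<lambda>_. borel) ((!) [G, S, U]) {..<3}"
    and distr_G: "distributed M lborel G (\<lambda>x. ennreal (std_normal_density x))"
    and distr_S: "distributed M lborel S (\<lambda>x. ennreal (std_normal_density x))"
    using model unfolding gaussian_model_def by auto
  have f [measurable]: "(\<lambda>(s, u). f s u) \<in> borel_measurable (borel \<Otimes>\<^sub>M borel)"
    and sign_f: "\<And>s u. f s u \<in> {-1, 1}"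
    using label unfolding label_function_def by auto
  have sign: "Y \<omega> \<in> {-1, 1}" for \<omega> unfolding Y by (rule sign_f)
  have indep': "indep_var borel (\<lambda>\<omega>. \<epsilon> * G \<omega>) borel (\<lambda>\<omega>. S \<omega> * Y \<omega>)" for \<epsilon>
  proof -
    have m0: "(\<lambda>x. \<epsilon> * x 0) \<in> borel_measurable (PiM {0::nat} (\<lambda>_. borel :: real measure))"
      by measurable
    have m1: "(\<lambda>x. x 1) \<in> borel_measurable (PiM {1, 2::nat} (\<lambda>_. borel :: real measure))"
      and m2: "(\<lambda>x. x 2) \<in> borel_measurable (PiM {1, 2::nat} (\<lambda>_. borel :: real measure))"
      by (rule measurable_component_singleton, simp)+
    have m12: "(\<lambda>x. x 1 * f (x 1) (x 2)) \<in> borel_measurable (PiM {1, 2::nat} (\<lambda>_. borel :: real measure))"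
      using measurable_compose[OF measurable_Pair[OF m1 m2] f] m1 by (simp add: borel_measurable_times)
    have "indep_var borel ((\<lambda>x. \<epsilon> * x 0) \<circ> (\<lambda>\<omega>. restrict (\<lambda>i. ((!) [G, S, U]) i \<omega>) {0}))
        borel ((\<lambda>x. x 1 * f (x 1) (x 2)) \<circ> (\<lambda>\<omega>. restrict (\<lambda>i. ((!) [G, S, U]) i \<omega>) {1, 2}))"
      by (rule indep_var_compose[OF indep_var_restrict[OF indep3] m0 m12]) auto
    then show ?thesis by (simp add: comp_def Y)
  qed
  have Y_meas: "Y \<in> borel_measurable M" by (rule gaussian_model_label_measurable[OF assms])
  obtain d where d: "d \<in> borel_measurable borel" "\<And>x. 0 \<le> d x" "\<And>x. d x \<le> 2 * std_normal_density x"
    and distr_X: "distributed M lborel (\<lambda>\<omega>. S \<omega> * Y \<omega>) (\<lambda>x. ennreal (d x))"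
    using signed_gaussian_density[OF distr_S Y_meas sign] by blast
  have X2: "(\<lambda>\<omega>. (S \<omega> * Y \<omega>)\<^sup>2) = (\<lambda>\<omega>. (S \<omega>)\<^sup>2)"
  proof
    fix \<omega> show "(S \<omega> * Y \<omega>)\<^sup>2 = (S \<omega>)\<^sup>2" using sign[of \<omega>] by auto
  qed
  have "integrable lborel (\<lambda>x. std_normal_density x * x\<^sup>2) \<longleftrightarrow> integrable M (\<lambda>\<omega>. (S \<omega>)\<^sup>2)"
    by (rule distributed_integrable[OF distr_S]) auto
  then have int: "integrable M (\<lambda>\<omega>. (S \<omega>)\<^sup>2)" using integrable_std_normal_moment[of 2] by simp
  have "(\<integral>x. std_normal_density x * x\<^sup>2 \<partial>lborel) = expectation (\<lambda>\<omega>. (S \<omega>)\<^sup>2)"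
    by (rule distributed_integral[OF distr_S]) auto
  then have one: "expectation (\<lambda>\<omega>. (S \<omega>)\<^sup>2) = 1" using integral_std_normal_moment_even[of 1] by simp
  have "(\<integral>x. d x * 1 \<partial>lborel) = expectation (\<lambda>_. 1)"
    by (rule distributed_integral[OF distr_X]) (use d in auto)
  then have total: "(\<integral>x. d x \<partial>lborel) = 1" using prob_space by simp
  have "gaussian_channel M d (\<lambda>\<omega>. \<epsilon> * G \<omega>) (\<lambda>\<omega>. S \<omega> * Y \<omega>)" if "\<epsilon> \<in> {-1, 1}" for \<epsilon> :: real
  proof unfold_locales
    show "distributed M lborel (\<lambda>\<omega>. \<epsilon> * G \<omega>) (\<lambda>x. ennreal (std_normal_density x))"
      using that normal_density_affine[OF distr_G, of \<epsilon> 0] by auto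
    show "integrable M (\<lambda>\<omega>. (S \<omega> * Y \<omega>)\<^sup>2)" "expectation (\<lambda>\<omega>. (S \<omega> * Y \<omega>)\<^sup>2) = 1"
      unfolding X2 by (fact int one)+
  qed (use d total distr_X indep' in auto)
  then show thesis by (rule that)
qed

section \<open>Comparison of the noise levels\<close>

text \<open>
A continuous function attains a level between two of its values, and its level set in a compact interval has a
smallest element; so the least element exists and is the one the intermediate value theorem bounds.
\<close>

lemma Least_level_le:
  fixes F :: "real \<Rightarrow> real"
  assumes cont: "continuous_on {0..} F" and "F 0 \<le> c" "c \<le> F b" "0 \<le> b"
  shows "(LEAST x. 0 \<le> x \<and> F x = c) \<le> b"
proof -
  have cont': "continuous_on {0..b} F" using cont by (rule continuous_on_subset) auto
  let ?A = "{x \<in> {0..b}. F x = c}"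
  have "closed ?A" using cont' by (rule continuous_closed_preimage_constant) simp
  moreover have "bounded ?A" by (rule bounded_subset[of "{0..b}"]) auto
  ultimately have "compact ?A" by (simp add: compact_eq_bounded_closed)
  moreover have "?A \<noteq> {}" using IVT'[OF assms(2,3,4) cont'] by auto
  ultimately obtain x where x: "x \<in> ?A" "\<forall>t\<in>?A. x \<le> t"
    using compact_attains_inf by blast
  have "(LEAST x. 0 \<le> x \<and> F x = c) = x"
  proof (rule Least_equality)
    fix t assume "0 \<le> t \<and> F t = c"
    then show "x \<le> t" using x by (cases "t \<le> b") auto
  qed (use x in auto)
  then show ?thesis using x by simp
qed

lemma (in gaussian_channel) kappa_eq_residual_energy:
  assumes "X = (\<lambda>\<omega>. S \<omega> * Y \<omega>)" "0 \<le> s"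
  shows "kappa M G S Y s = residual_energy s"
proof (cases "s = 0")
  case True
  then show ?thesis by (simp add: kappa_def residual_energy_0)
next
  case False
  with assms have s: "0 < s" by simp
  have I: "fisher_info M (\<lambda>\<omega>. s * G \<omega> + S \<omega> * Y \<omega>) = noise_energy s / s\<^sup>2"
    using fisher_info_received[OF s] unfolding received_def[abs_def] unfolding assms(1) .
  let ?J = "noise_energy s"
  have "s\<^sup>2 * (s\<^sup>2 * (?J / s\<^sup>2) + ?J / s\<^sup>2 - 1) = s\<^sup>2 * ?J + ?J - s\<^sup>2"
    "1 + s\<^sup>2 * (s\<^sup>2 * (?J / s\<^sup>2) - 1) = signal_energy s"
    using s by (simp_all add: field_simps signal_energy_def)
  then show ?thesis using False unfolding kappa_def I residual_energy_def Let_def by (simp only: if_False)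
qed

text \<open>
For \<open>\<alpha> = 0\<close> the second equation makes the derivative of the envelope vanish almost surely, which means that its
argument minimises the loss. Minimising the loss is independent of \<open>lam\<close>.
\<close>

lemma system_solution_noiseless_rescale:
  assumes convex: "convex_on UNIV loss" and sol: "system_solution M G S Y loss \<delta> \<mu> 0 lam" and \<delta>: "\<delta> \<noteq> 0"
    and [measurable]: "G \<in> borel_measurable M" "S \<in> borel_measurable M" "Y \<in> borel_measurable M"
  shows "system_solution M G S Y loss \<delta> \<mu> 0 (2 * lam)"
proof -
  let ?D = "\<lambda>lam \<omega>. moreau_deriv loss (0 * G \<omega> + \<mu> * S \<omega> * Y \<omega>) lam"
  have lam: "0 < lam" and int: "integrable M (\<lambda>\<omega>. (?D lam \<omega>)\<^sup>2)"
    and "lam\<^sup>2 * \<delta> * (\<integral>\<omega>. (?D lam \<omega>)\<^sup>2 \<partial>M) = 0"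
    using sol unfolding system_solution_def Let_def by auto
  then have "(\<integral>\<omega>. (?D lam \<omega>)\<^sup>2 \<partial>M) = 0" using \<delta> by simp
  then have "AE \<omega> in M. (?D lam \<omega>)\<^sup>2 = 0"
    using integral_nonneg_eq_0_iff_AE[OF int] by simp
  then have zero: "AE \<omega> in M. ?D (2 * lam) \<omega> = 0"
  proof eventually_elim
    fix \<omega> assume "(?D lam \<omega>)\<^sup>2 = 0"
    then have "moreau_deriv loss (0 * G \<omega> + \<mu> * S \<omega> * Y \<omega>) lam = 0" by simp
    from moreau_deriv_zero_imp_minimizer[OF convex lam this]
    show "?D (2 * lam) \<omega> = 0"
      using lam by (intro minimizer_imp_moreau_deriv_zero[OF convex]) auto
  qed
  have [measurable]: "(\<lambda>x. moreau_deriv loss x (2 * lam)) \<in> borel_measurable borel"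
    using lam by (intro moreau_deriv_measurable[OF convex]) simp
  have [measurable]: "?D (2 * lam) \<in> borel_measurable M" by measurable
  have vanish: "integrable M F \<and> (\<integral>\<omega>. F \<omega> \<partial>M) = 0"
    if "F \<in> borel_measurable M" "AE \<omega> in M. F \<omega> = 0" for F :: "'a \<Rightarrow> real"
    using that integrable_cong_AE[of F M "\<lambda>_. 0"] integral_eq_zero_AE by auto
  have "integrable M (\<lambda>\<omega>. Y \<omega> * S \<omega> * ?D (2 * lam) \<omega>) \<and> (\<integral>\<omega>. Y \<omega> * S \<omega> * ?D (2 * lam) \<omega> \<partial>M) = 0"
    "integrable M (\<lambda>\<omega>. (?D (2 * lam) \<omega>)\<^sup>2) \<and> (\<integral>\<omega>. (?D (2 * lam) \<omega>)\<^sup>2 \<partial>M) = 0"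
    "integrable M (\<lambda>\<omega>. G \<omega> * ?D (2 * lam) \<omega>) \<and> (\<integral>\<omega>. G \<omega> * ?D (2 * lam) \<omega> \<partial>M) = 0"
    by (rule vanish, measurable, use zero in eventually_elim, simp)+
  then show ?thesis using lam unfolding system_solution_def Let_def by simp
qed

theorem theorem3p1:
  fixes M :: "'w measure" and \<nu> :: "real measure"
    and loss :: "real \<Rightarrow> real" and f :: "real \<Rightarrow> real \<Rightarrow> real"
    and m n :: "nat \<Rightarrow> nat" and \<delta> :: real
    and x0 :: "nat \<Rightarrow> nat \<Rightarrow> real"
    and a :: "nat \<Rightarrow> nat \<Rightarrow> nat \<Rightarrow> 'w \<Rightarrow> real" and u :: "nat \<Rightarrow> nat \<Rightarrow> 'w \<Rightarrow> real"
    and y :: "nat \<Rightarrow> nat \<Rightarrow> 'w \<Rightarrow> real"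
    and G S U Y :: "'w \<Rightarrow> real"
    and \<mu> \<alpha> lam :: real
  assumes "prob_space M"
    and "convex_on UNIV loss"
    and "label_function f"
    and "filterlim m at_top sequentially" and "filterlim n at_top sequentially"
    and "(\<lambda>k. real (m k) / real (n k)) \<longlonglongrightarrow> \<delta>" and "1 < \<delta>"
    and "\<And>k. L2_set (x0 k) {..<n k} = 1"
    and "\<And>k. gaussian_features M \<nu> (m k) (n k) (a k) (u k)"
    and "\<And>k i \<omega>. y k i \<omega> = f (dotp (n k) (\<lambda>j. a k i j \<omega>) (x0 k)) (u k i \<omega>)"
    and "(\<lambda>k. measure M {\<omega> \<in> space M. bounded_vectors (n k)
             (minimizers loss (m k) (n k) (\<lambda>i j. a k i j \<omega>) (\<lambda>i. y k i \<omega>))}) \<longlonglongrightarrow> 1"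
    and "gaussian_model M \<nu> G S U"
    and "\<And>\<omega>. Y \<omega> = f (S \<omega>) (U \<omega>)"
    and "system_solution M G S Y loss \<delta> \<mu> \<alpha> lam"
    and "\<And>\<mu>' \<alpha>' lam'. system_solution M G S Y loss \<delta> \<mu>' \<alpha>' lam' \<Longrightarrow>
           \<mu>' = \<mu> \<and> \<alpha>' = \<alpha> \<and> lam' = lam"
    and "\<mu> \<noteq> 0"
  shows "sigma_loss \<mu> \<alpha> \<ge> sigma_opt M G S Y \<delta>"
proof -
  note convex = assms(2) and \<delta> = \<open>1 < \<delta>\<close> and Y = assms(13) and sol = assms(14)
    and unique = assms(15)
  interpret prob_space M by fact
  define X where "X = (\<lambda>\<omega>. S \<omega> * Y \<omega>)"
  obtain d where channel: "\<And>\<epsilon>. \<epsilon> \<in> {-1, 1} \<Longrightarrow> gaussian_channel M d (\<lambda>\<omega>. \<epsilon> * G \<omega>) X"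
    using gaussian_model_channel[OF assms(12) assms(3) Y] unfolding X_def by blast
  interpret C: gaussian_channel M d G X using channel[of 1] by simp
  \<comment> \<open>With noise \<open>\<epsilon> G\<close> the argument of the envelope is \<open>\<mu>\<close> times the observation at a positive
    noise level, for either sign of \<open>\<mu>\<close>.\<close>
  define \<epsilon> where "\<epsilon> = sgn \<mu>"
  have \<epsilon>: "\<epsilon> \<in> {-1, 1}" "\<epsilon>\<^sup>2 = 1" "\<bar>\<mu>\<bar> = \<mu> * \<epsilon>"
    using \<open>\<mu> \<noteq> 0\<close> unfolding \<epsilon>_def by (auto simp: sgn_if)
  interpret C': gaussian_channel M d "\<lambda>\<omega>. \<epsilon> * G \<omega>" X using channel[OF \<epsilon>(1)] .
  let ?D = "\<lambda>\<omega>. moreau_deriv loss (\<alpha> * G \<omega> + \<mu> * S \<omega> * Y \<omega>) lam"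
  have \<alpha>0: "0 \<le> \<alpha>" and lam: "0 < lam"
    and int: "integrable M (\<lambda>\<omega>. Y \<omega> * S \<omega> * ?D \<omega>)" "integrable M (\<lambda>\<omega>. (?D \<omega>)\<^sup>2)"
      "integrable M (\<lambda>\<omega>. G \<omega> * ?D \<omega>)"
    and eqs: "(\<integral>\<omega>. Y \<omega> * S \<omega> * ?D \<omega> \<partial>M) = 0"
      "lam\<^sup>2 * \<delta> * (\<integral>\<omega>. (?D \<omega>)\<^sup>2 \<partial>M) = \<alpha>\<^sup>2"
      "lam * \<delta> * (\<integral>\<omega>. G \<omega> * ?D \<omega> \<partial>M) = \<alpha>"
    using sol unfolding system_solution_def Let_def by auto
  have "\<alpha> \<noteq> 0"
  proof
    assume "\<alpha> = 0"
    have S: "S \<in> borel_measurable M"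
      using assms(12) unfolding gaussian_model_def by (auto dest: distributed_measurable)
    have "Y \<in> borel_measurable M"
      by (rule gaussian_model_label_measurable[OF assms(12) assms(3) Y])
    then have "system_solution M G S Y loss \<delta> \<mu> 0 (2 * lam)"
      using sol \<delta> \<open>\<alpha> = 0\<close> S by (intro system_solution_noiseless_rescale[OF convex]) auto
    from unique[OF this] lam show False by simp
  qed
  with \<alpha>0 have \<alpha>: "0 < \<alpha>" by simp
  define \<sigma> where "\<sigma> = \<alpha> / \<bar>\<mu>\<bar>"
  have \<sigma>: "0 < \<sigma>" unfolding \<sigma>_def using \<alpha> \<open>\<mu> \<noteq> 0\<close> by simp
  define h where "h w = moreau_deriv loss (\<mu> * w) lam" for w
  have [measurable]: "(\<lambda>x. moreau_deriv loss x lam) \<in> borel_measurable borel"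
    by (rule moreau_deriv_measurable[OF convex lam])
  have h_meas: "h \<in> borel_measurable borel" unfolding h_def[abs_def] by measurable
  have arg: "\<mu> * C'.received \<sigma> \<omega> = \<alpha> * G \<omega> + \<mu> * S \<omega> * Y \<omega>" for \<omega>
  proof -
    have "\<mu> * \<sigma> * \<epsilon> = \<alpha>" unfolding \<sigma>_def \<epsilon>(3) using \<epsilon>(1) \<open>\<mu> \<noteq> 0\<close> by auto
    then show ?thesis unfolding C'.received_def unfolding X_def by (simp add: algebra_simps)
  qed
  have D: "h (C'.received \<sigma> \<omega>) = ?D \<omega>" for \<omega> unfolding h_def arg ..
  define E2 EG where "E2 = expectation (\<lambda>\<omega>. (?D \<omega>)\<^sup>2)" and "EG = expectation (\<lambda>\<omega>. G \<omega> * ?D \<omega>)"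
  have XD: "(\<lambda>\<omega>. X \<omega> * ?D \<omega>) = (\<lambda>\<omega>. Y \<omega> * S \<omega> * ?D \<omega>)" unfolding X_def by (simp add: mult_ac)
  have "(expectation (\<lambda>\<omega>. \<epsilon> * G \<omega> * ?D \<omega>))\<^sup>2 \<le> C.residual_energy \<sigma> * E2"
    using C'.correlation_bound[OF \<sigma> h_meas] int eqs(1) unfolding D E2_def XD
    by (simp add: mult.assoc)
  then have "EG\<^sup>2 \<le> C.residual_energy \<sigma> * E2"
    unfolding EG_def using \<epsilon>(2) by (simp add: mult.assoc power_mult_distrib)
  moreover have "EG = \<alpha> / (lam * \<delta>)" "E2 = \<alpha>\<^sup>2 / (lam\<^sup>2 * \<delta>)"
    using eqs(2,3) lam \<delta> unfolding EG_def E2_def by (simp_all add: field_simps)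
  ultimately have "\<alpha>\<^sup>2 / (lam\<^sup>2 * \<delta>) * (1 / \<delta>) \<le> \<alpha>\<^sup>2 / (lam\<^sup>2 * \<delta>) * C.residual_energy \<sigma>"
    by (simp add: power_divide power_mult_distrib power2_eq_square[of \<delta>] mult_ac)
  then have "1 / \<delta> \<le> C.residual_energy \<sigma>"
    using \<alpha> lam \<delta> by (subst (asm) mult_le_cancel_left_pos) auto
  then have "(LEAST s. 0 \<le> s \<and> C.residual_energy s = 1 / \<delta>) \<le> \<sigma>"
    using \<delta> \<sigma> by (intro Least_level_le C.continuous_on_residual_energy) (auto simp: C.residual_energy_0)
  moreover have "sigma_opt M G S Y \<delta> = (LEAST s. 0 \<le> s \<and> C.residual_energy s = 1 / \<delta>)"
  proof -
    have "(0 \<le> s \<and> kappa M G S Y s = 1 / \<delta>) \<longleftrightarrow> (0 \<le> s \<and> C.residual_energy s = 1 / \<delta>)" for s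
      using C.kappa_eq_residual_energy[OF X_def] by auto
    then show ?thesis unfolding sigma_opt_def by simp
  qed
  moreover have "sigma_loss \<mu> \<alpha> = \<sigma>" unfolding sigma_loss_def \<sigma>_def using \<alpha> by (simp add: abs_divide)
  ultimately show ?thesis by simp
qed

end
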